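(* Let $\chi\in\Pi_\infty$ have more than one point of support. Consider the recursive tree system $(\chi,h)$ with automaton distribution map $\Psi$, and assume that $h(\ell)$ is (nonstrictly) increasing in $\ell$. Let $m\geq 1$, suppose that $(\chi,h)$ is $m$-supercordant, and let $x_0$ be the smallest nonzero fixed point of $\Psi$. Then $x_0$ is interpretable, i.e. there is an interpretation of $(\chi,h)$ of $\mathrm{GW}_\chi$-measure $x_0$, and its associated interpretation is the event that $T\sim\mathrm{GW}_\chi$ contains an admissible subtree $S$ in which all but finitely many vertices $v$ satisfy $n_S(v)\leq m$.
   Context: A child distribution $\chi$ is a probability measure on $\mathbb{N}=\{0,1,2,\ldots\}$; write $\chi(n)=\chi(\{n\})$. $\Pi_\infty$ is the set of probability measures on $\mathbb{N}$ with all moments finite. A recursive tree system $(\chi,h)$ consists of a child distribution $\chi$ and a threshold function $h\colon\mathbb{N}\to\{1,2,3,\ldots\}$ (so $h(\ell)\geq 1$ for all $\ell\geq 0$). Its automaton distribution map is $\Psi\colon[0,1]\to[0,1]$, $\Psi(x)=\sum_{\ell=0}^\infty \chi(\ell)\,\mathbb{P}[\mathrm{Bin}(\ell,x)\geq h(\ell)]$, where $\mathrm{Bin}(\ell,x)$ is a binomial random variable. Derivatives at $0$ are one-sided. $\mathrm{GW}_\chi$ is the Galton--Watson measure with child distribution $\chi$ on the space of rooted trees. For a rooted tree $t$, $\ell(t)$ is the number of children of the root, and the root-child subtrees of $t$ are the subtrees originated by the children of the root. For a set of trees $\mathcal{T}$, $c(t,\mathcal{T})$ is the number of root-child subtrees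 of $t$ that are elements of $\mathcal{T}$. A $\mathrm{GW}_\chi$-measurable set of trees $\mathcal{T}$ is an interpretation of $(\chi,h)$ if, for $\mathrm{GW}_\chi$-a.e. rooted tree $t$, $t\in\mathcal{T}\iff c(t,\mathcal{T})\geq h(\ell(t))$. It is said to be associated with the fixed point $x_0$ if $\mathrm{GW}_\chi(\mathcal{T})=x_0$ (interpretations are considered up to $\mathrm{GW}_\chi$-negligible sets). For $m\geq1$, $(\chi,h)$ is $m$-concordant if $\Psi'(0)=1$ and $\Psi^{(k)}(0)=0$ for $2\leq k\leq m$. It is $1$-supercordant if $\Psi'(0)>1$; for $m\geq 2$ it is $m$-supercordant if it is $(m-1)$-concordant and $\Psi^{(m)}(0)>0$. $n_t(v)$ denotes the number of children of a vertex $v$ in a rooted tree $t$. A subtree $s$ of a rooted tree $t$ is admissible (with respect to $h$) if $s$ contains the root of $t$ and $n_s(v)\geq h(n_t(v))$ for all vertices $v\in s$. *)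

theory Defs
  imports "HOL-Probability.Probability"
begin

section \<open>Rooted trees\<close>

text \<open>
  A locally finite rooted tree is encoded as its set of vertices in Ulam--Harris notation: the
  root is the empty list, and the children of \<open>v\<close> are the vertices \<open>v @ [i]\<close>, numbered
  \<open>0, 1, \<dots>, n - 1\<close>. The numbering serves only to make the space of trees concrete.
\<close>

type_synonym vertex = "nat list"

definition rooted_trees :: "vertex set set" where
  "rooted_trees = {t. [] \<in> t
     \<and> (\<forall>v i. v @ [i] \<in> t \<longrightarrow> v \<in> t)
     \<and> (\<forall>v i j. v @ [i] \<in> t \<longrightarrow> j < i \<longrightarrow> v @ [j] \<in> t)
     \<and> (\<forall>v. finite {i. v @ [i] \<in> t})}"

definition n_children :: "vertex set \<Rightarrow> vertex \<Rightarrow> nat" where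
  "n_children t v = card {i. v @ [i] \<in> t}"

definition root_child_subtree :: "vertex set \<Rightarrow> nat \<Rightarrow> vertex set" where
  "root_child_subtree t i = {v. i # v \<in> t}"

definition root_child_count :: "vertex set \<Rightarrow> vertex set set \<Rightarrow> nat" where
  "root_child_count t \<T> = card {i. [i] \<in> t \<and> root_child_subtree t i \<in> \<T>}"

text \<open>
  A subtree containing the root is a set of vertices that contains the root and is closed under
  taking parents. Since it may use any of the children of a vertex of \<open>t\<close>, it need not be an
  element of \<^const>\<open>rooted_trees\<close>.
\<close>

definition admissible_subtree :: "(nat \<Rightarrow> nat) \<Rightarrow> vertex set \<Rightarrow> vertex set \<Rightarrow> bool" where
  "admissible_subtree h t s \<longleftrightarrow> s \<subseteq> t \<and> [] \<in> s \<and> (\<forall>v i. v @ [i] \<in> s \<longrightarrow> v \<in> s)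
     \<and> (\<forall>v\<in>s. n_children s v \<ge> h (n_children t v))"


section \<open>The Galton--Watson measure\<close>

definition tree_algebra :: "vertex set measure" where
  "tree_algebra = sigma rooted_trees (range (\<lambda>v. {t \<in> rooted_trees. v \<in> t}))"

text \<open>The tree in which each vertex \<open>v\<close> has \<open>X v\<close> children:\<close>

definition tree_of :: "(vertex \<Rightarrow> nat) \<Rightarrow> vertex set" where
  "tree_of X = {v. \<forall>k<length v. v ! k < X (take k v)}"

definition GW :: "nat pmf \<Rightarrow> vertex set measure" where
  "GW chi = distr (\<Pi>\<^sub>M v\<in>UNIV. measure_pmf chi) tree_algebra tree_of"

lemma append_in_tree_of_iff: "v @ [i] \<in> tree_of X \<longleftrightarrow> v \<in> tree_of X \<and> i < X v"
  by (auto simp: tree_of_def nth_append less_Suc_eq)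

lemma tree_of_in_rooted_trees: "tree_of X \<in> rooted_trees"
proof -
  have "[] \<in> tree_of X"
    by (simp add: tree_of_def)
  moreover have "finite {i. v @ [i] \<in> tree_of X}" for v
    by (rule finite_subset[of _ "{..<X v}"]) (auto simp: append_in_tree_of_iff)
  ultimately show ?thesis
    by (auto simp: rooted_trees_def append_in_tree_of_iff)
qed

lemma measurable_tree_of: "tree_of \<in> (\<Pi>\<^sub>M v\<in>UNIV. measure_pmf chi) \<rightarrow>\<^sub>M tree_algebra"
  unfolding tree_algebra_def
proof (rule measurable_measure_of)
  show "range (\<lambda>v. {t \<in> rooted_trees. v \<in> t}) \<subseteq> Pow rooted_trees"
    by auto
  show "tree_of \<in> space (\<Pi>\<^sub>M v\<in>UNIV. measure_pmf chi) \<rightarrow> rooted_trees"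
    using tree_of_in_rooted_trees by blast
next
  fix A :: "vertex set set"
  assume "A \<in> range (\<lambda>v. {t \<in> rooted_trees. v \<in> t})"
  then obtain v where A: "A = {t \<in> rooted_trees. v \<in> t}"
    by blast
  let ?M = "\<Pi>\<^sub>M v\<in>(UNIV :: vertex set). measure_pmf chi"
  have "{X \<in> space ?M. \<forall>k\<in>{..<length v}. v ! k < X (take k v)} \<in> sets ?M"
  proof (rule sets.sets_Collect_finite_All)
    fix k
    have "(\<lambda>X. X (take k v)) \<in> ?M \<rightarrow>\<^sub>M measure_pmf chi"
      by (rule measurable_component_singleton) simp
    from measurable_sets[OF this, of "{v ! k<..}"]
    have "(\<lambda>X. X (take k v)) -` {v ! k<..} \<inter> space ?M \<in> sets ?M"
      by simp
    moreover have "(\<lambda>X. X (take k v)) -` {v ! k<..} \<inter> space ?M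
                     = {X \<in> space ?M. v ! k < X (take k v)}"
      by auto
    ultimately show "{X \<in> space ?M. v ! k < X (take k v)} \<in> sets ?M"
      by simp
  qed auto
  moreover have "tree_of -` A \<inter> space ?M
                   = {X \<in> space ?M. \<forall>k\<in>{..<length v}. v ! k < X (take k v)}"
    using tree_of_in_rooted_trees by (auto simp: A tree_of_def)
  ultimately show "tree_of -` A \<inter> space ?M \<in> sets ?M"
    by simp
qed

lemma prob_space_GW: "prob_space (GW chi)"
  unfolding GW_def
  by (intro prob_space.prob_space_distr prob_space_PiM measurable_tree_of
      prob_space_measure_pmf)


section \<open>Recursive tree systems\<close>

definition all_moments_finite :: "nat pmf \<Rightarrow> bool" where
  "all_moments_finite chi \<longleftrightarrow> (\<forall>k. integrable (measure_pmf chi) (\<lambda>n. real n ^ k))"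

text \<open>Only the values on \<open>{0..1}\<close> are meaningful.\<close>

definition automaton_map :: "nat pmf \<Rightarrow> (nat \<Rightarrow> nat) \<Rightarrow> real \<Rightarrow> real" where
  "automaton_map chi h x =
     (\<Sum>l. pmf chi l * measure_pmf.prob (binomial_pmf l x) {h l..})"

text \<open>
  The \<open>k\<close>-th derivative of a function on \<open>{0..1}\<close>, one-sided at the endpoints. When all moments of
  \<open>chi\<close> are finite, \<open>automaton_map chi h\<close> is infinitely differentiable on \<open>{0..1}\<close>, so that
  \<^const>\<open>vector_derivative\<close> is applied only where the derivative exists.
\<close>

definition unit_interval_deriv :: "nat \<Rightarrow> (real \<Rightarrow> real) \<Rightarrow> real \<Rightarrow> real" where
  "unit_interval_deriv k f =
     ((\<lambda>g x. vector_derivative g (at x within {0..1})) ^^ k) f"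

definition concordant :: "nat \<Rightarrow> nat pmf \<Rightarrow> (nat \<Rightarrow> nat) \<Rightarrow> bool" where
  "concordant m chi h \<longleftrightarrow> m \<ge> 1
     \<and> unit_interval_deriv 1 (automaton_map chi h) 0 = 1
     \<and> (\<forall>k\<in>{2..m}. unit_interval_deriv k (automaton_map chi h) 0 = 0)"

definition supercordant :: "nat \<Rightarrow> nat pmf \<Rightarrow> (nat \<Rightarrow> nat) \<Rightarrow> bool" where
  "supercordant m chi h \<longleftrightarrow>
     (m = 1 \<and> unit_interval_deriv 1 (automaton_map chi h) 0 > 1)
     \<or> (m \<ge> 2 \<and> concordant (m - 1) chi h \<and> unit_interval_deriv m (automaton_map chi h) 0 > 0)"

text \<open>\<open>GW chi\<close>-measurable sets are those of the completed \<open>\<sigma>\<close>-algebra.\<close>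

definition interpretation_of :: "nat pmf \<Rightarrow> (nat \<Rightarrow> nat) \<Rightarrow> vertex set set \<Rightarrow> bool" where
  "interpretation_of chi h \<T> \<longleftrightarrow> \<T> \<in> sets (completion (GW chi))
     \<and> (AE t in GW chi. t \<in> \<T> \<longleftrightarrow> root_child_count t \<T> \<ge> h (n_children t []))"

definition associated_interpretation ::
    "nat pmf \<Rightarrow> (nat \<Rightarrow> nat) \<Rightarrow> real \<Rightarrow> vertex set set \<Rightarrow> bool" where
  "associated_interpretation chi h x \<T> \<longleftrightarrow>
     interpretation_of chi h \<T> \<and> measure (completion (GW chi)) \<T> = x"

definition interpretable :: "nat pmf \<Rightarrow> (nat \<Rightarrow> nat) \<Rightarrow> real \<Rightarrow> bool" where
  "interpretable chi h x \<longleftrightarrow> (\<exists>\<T>. associated_interpretation chi h x \<T>)"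

definition eventually_bounded_admissible_event ::
    "(nat \<Rightarrow> nat) \<Rightarrow> nat \<Rightarrow> vertex set set" where
  "eventually_bounded_admissible_event h m =
     {t \<in> rooted_trees. \<exists>s. admissible_subtree h t s \<and> finite {v \<in> s. \<not> n_children s v \<le> m}}"

end

theory Submission
  imports Defs
begin

text \<open>
  Let \<open>\<Psi>\<close> be the automaton map and \<open>\<Psi>\<^sub>m\<close> the same sum over those \<open>l\<close> with \<open>h l \<le> m\<close> only. Let
  \<open>B\<close> be the event that some admissible subtree has at most \<open>m\<close> children at every vertex
  (\<open>bounded_event\<close>). It is the largest event reproduced by the recursive threshold rule restricted to
  \<open>h l \<le> m\<close>, and its probability \<open>q\<close> is a fixed point of \<open>\<Psi>\<^sub>m\<close>. Iterating the unrestricted rule from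
  \<open>B\<close> gives an increasing sequence of events whose union is the event \<open>E\<close> of the theorem
  (\<open>eventually_bounded_admissible_event_eq\<close>). So \<open>E\<close> is an interpretation, and its probability is the
  limit of the iterates of \<open>\<Psi>\<close> from \<open>q\<close>, a fixed point of \<open>\<Psi>\<close>. As \<open>\<Psi>\<close> is increasing, this limit is
  the smallest nonzero fixed point \<open>x\<^sub>0\<close> as soon as \<open>0 < q \<le> x\<^sub>0\<close>.

  At \<open>0\<close>, the thresholds above \<open>m\<close> contribute only at order \<open>m + 1\<close>. Hence \<open>\<Psi>\<^sub>m\<close> inherits from
  supercordance that it exceeds the identity near \<open>0\<close>, and \<open>q > 0\<close>. The inequality \<open>q \<le> x\<^sub>0\<close> is the
  heart of the proof. As \<open>\<Psi> \<ge> \<Psi>\<^sub>m\<close>, it suffices that \<open>\<Psi>\<^sub>m x > x\<close> for \<open>0 < x < q\<close>, and for this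
  that \<open>\<Psi>\<^sub>m' - 1\<close> changes sign at most once on the unit interval, from positive to negative. Since the
  identity is the binomial tail with \<open>l = h l = 1\<close>, this derivative is a combination of the functions
  \<open>x ^ (h l - 1) * (1 - x) ^ (l - h l)\<close> in which only the coefficient of \<open>l = 1\<close> is negative. If \<open>h\<close>
  were constant, it would be a power series in \<open>1 - x\<close> with one sign change among its coefficients.
  In general the terms are added in the order of \<open>l\<close>. Whenever the threshold jumps above some
  \<open>k < m\<close>, concordance forces the part summed so far, which is \<open>x ^ (k - 1)\<close> times a polynomial in
  \<open>1 - x\<close>, to vanish at \<open>0\<close> to one order more. Dividing the polynomial by \<open>x\<close> replaces its coefficients
  by their partial sums, which are all nonpositive (\<open>sign_changing_poly_divide\<close>). The later terms come
  with higher powers of \<open>1 - x\<close> and nonnegative coefficients, so there is still only one sign change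
  (\<open>factored_threshold\<close>, \<open>low_deriv_factorization\<close>, \<open>low_positive_before\<close>).

  Uniqueness holds for every fixed point. Given finitely many levels of the tree, the subtrees below
  them belong to an interpretation independently and with its probability, and they decide whether
  the tree does. So two interpretations of equal measure cannot be told apart by intersecting them
  with events that depend on finitely many levels, and these generate all events
  (\<open>interpretation_event_unique\<close>).
\<close>

section \<open>Derivatives of binomial tail probabilities\<close>

text \<open>
  The derivative of a Bernstein polynomial is a difference of two Bernstein polynomials of degree
  one less, times the degree. Iterating this recursion makes the size of all derivatives visible.
\<close>

fun Bernstein_deriv :: "nat \<Rightarrow> nat \<Rightarrow> nat \<Rightarrow> real \<Rightarrow> real" where
  "Bernstein_deriv 0 n k x = Bernstein n k x"
| "Bernstein_deriv (Suc i) 0 k x = 0"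
| "Bernstein_deriv (Suc i) (Suc n) 0 x = - real (Suc n) * Bernstein_deriv i n 0 x"
| "Bernstein_deriv (Suc i) (Suc n) (Suc k) x =
     real (Suc n) * (Bernstein_deriv i n k x - Bernstein_deriv i n (Suc k) x)"

lemma Bernstein_eq_0: "n < k \<Longrightarrow> Bernstein n k x = 0"
  by (simp add: Bernstein_def)

lemma Bernstein_le_1:
  assumes "0 \<le> x" "x \<le> 1"
  shows "Bernstein n k x \<le> 1"
proof (cases "k \<le> n")
  case True
  then have "Bernstein n k x \<le> (\<Sum>k\<le>n. Bernstein n k x)"
    using assms by (intro member_le_sum) (auto intro: Bernstein_nonneg)
  then show ?thesis by simp
qed (simp add: Bernstein_eq_0)

lemma has_real_derivative_Bernstein:
  "(Bernstein n k has_real_derivative Bernstein_deriv 1 n k x) (at x)"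
proof (cases n)
  case 0
  have "Bernstein 0 k = (\<lambda>x. real (0 choose k) * (if k = 0 then 1 else 0))"
    by (auto simp: Bernstein_def fun_eq_iff binomial_eq_0)
  then show ?thesis using 0 by simp
next
  case n: (Suc n')
  show ?thesis
  proof (cases k)
    case 0
    have "((\<lambda>x::real. (1 - x) ^ Suc n') has_real_derivative - real (Suc n') * (1 - x) ^ n') (at x)"
      by (rule derivative_eq_intros refl | simp)+ (simp add: algebra_simps)
    moreover have "Bernstein (Suc n') 0 = (\<lambda>x. (1 - x) ^ Suc n')"
      by (simp add: Bernstein_def fun_eq_iff)
    ultimately show ?thesis
      using 0 n by (simp add: Bernstein_def mult.commute)
  next
    case k: (Suc k')
    consider "k' < n'" | "k' = n'" | "n' < k'" by linarith
    then show ?thesis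
    proof cases
      case 1
      then obtain d where d: "n' = Suc (k' + d)"
        using less_iff_Suc_add by blast
      have B: "Bernstein (Suc n') (Suc k') = (\<lambda>x. real (Suc n' choose Suc k') * x ^ Suc k' * (1 - x) ^ Suc d)"
        by (simp add: Bernstein_def fun_eq_iff d)
      have c1: "real (Suc n') * real (n' choose k') = real (Suc n' choose Suc k') * real (Suc k')"
        by (metis Suc_times_binomial_eq of_nat_mult)
      have c2: "real (Suc n') * real (n' choose Suc k') = real (Suc n' choose Suc k') * real (Suc d)"
      proof -
        have "(Suc n' choose Suc k') * (Suc n' - Suc k') = Suc n' * (n' choose Suc k')"
          using binomial_absorb_comp[of "Suc n'" "Suc k'"] by (simp add: mult.commute)
        then have "(Suc n' choose Suc k') * Suc d = Suc n' * (n' choose Suc k')"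
          by (simp add: d)
        then show ?thesis by (metis of_nat_mult)
      qed
      have "(Bernstein (Suc n') (Suc k') has_real_derivative
          real (Suc n' choose Suc k') * (real (Suc k') * x ^ k' * (1 - x) ^ Suc d
             - x ^ Suc k' * (real (Suc d) * (1 - x) ^ d))) (at x)"
        unfolding B
        by (rule derivative_eq_intros refl | simp)+ (simp add: algebra_simps)
      also have "real (Suc n' choose Suc k') * (real (Suc k') * x ^ k' * (1 - x) ^ Suc d
             - x ^ Suc k' * (real (Suc d) * (1 - x) ^ d))
         = (real (Suc n' choose Suc k') * real (Suc k')) * (x ^ k' * (1 - x) ^ Suc d)
           - (real (Suc n' choose Suc k') * real (Suc d)) * (x ^ Suc k' * (1 - x) ^ d)"
        by (simp add: algebra_simps)
      also have "\<dots> = real (Suc n') * (Bernstein n' k' x - Bernstein n' (Suc k') x)"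
      proof -
        have e: "Bernstein n' k' x = real (n' choose k') * (x ^ k' * (1 - x) ^ Suc d)"
          "Bernstein n' (Suc k') x = real (n' choose Suc k') * (x ^ Suc k' * (1 - x) ^ d)"
          using d by (auto simp: Bernstein_def Suc_diff_le)
        show ?thesis
          unfolding c1[symmetric] c2[symmetric] e right_diff_distrib mult.assoc ..
      qed
      finally show ?thesis using n k by simp
    next
      case 2
      have B: "Bernstein (Suc n') (Suc n') = (\<lambda>x. x ^ Suc n')"
        by (simp add: Bernstein_def fun_eq_iff)
      have "(Bernstein (Suc n') (Suc n') has_real_derivative real (Suc n') * x ^ n') (at x)"
        unfolding B by (rule derivative_eq_intros refl | simp)+
      then show ?thesis using n k 2 by (simp add: Bernstein_def binomial_eq_0)
    next
      case 3
      then have "Bernstein (Suc n') (Suc k') = (\<lambda>x. 0)"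
        by (simp add: Bernstein_eq_0 fun_eq_iff)
      then show ?thesis using n k 3 by (simp add: Bernstein_eq_0)
    qed
  qed
qed

lemma has_real_derivative_Bernstein_deriv:
  "(Bernstein_deriv i n k has_real_derivative Bernstein_deriv (Suc i) n k x) (at x)"
proof (induction i n k x rule: Bernstein_deriv.induct)
  case (1 n k x)
  have "Bernstein_deriv 0 n k = Bernstein n k" by (simp add: fun_eq_iff)
  then show ?case using has_real_derivative_Bernstein[of n k x] by simp
next
  case (2 i k x)
  have "Bernstein_deriv (Suc i) 0 k = (\<lambda>_. 0)" by (simp add: fun_eq_iff)
  then show ?case by simp
next
  case (3 i n x)
  have "Bernstein_deriv (Suc i) (Suc n) 0 = (\<lambda>x. - real (Suc n) * Bernstein_deriv i n 0 x)"
    by (simp add: fun_eq_iff)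
  then show ?case
    using DERIV_cmult[OF 3, of "- real (Suc n)"] by simp
next
  case (4 i n k x)
  have "Bernstein_deriv (Suc i) (Suc n) (Suc k) =
    (\<lambda>x. real (Suc n) * (Bernstein_deriv i n k x - Bernstein_deriv i n (Suc k) x))"
    by (simp add: fun_eq_iff)
  then show ?case
    using DERIV_cmult[OF DERIV_diff[OF 4], of "real (Suc n)"] by simp
qed

text \<open>
  Each differentiation costs a factor of at most twice the degree. This polynomial growth is what
  finite moments of the child distribution can absorb.
\<close>

lemma Bernstein_deriv_bound:
  assumes "0 \<le> x" "x \<le> 1"
  shows "\<bar>Bernstein_deriv i n k x\<bar> \<le> (2 * real n) ^ i"
  using assms
proof (induction i n k x rule: Bernstein_deriv.induct)
  case (1 n k x)
  then show ?case
    by (simp add: Bernstein_nonneg Bernstein_le_1)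
next
  case (3 i n x)
  have "(2 * real n) ^ i \<le> (2 * real (Suc n)) ^ i"
    by (intro power_mono) auto
  with 3 have "\<bar>Bernstein_deriv i n 0 x\<bar> \<le> (2 * real (Suc n)) ^ i"
    by auto
  then have "real (Suc n) * \<bar>Bernstein_deriv i n 0 x\<bar> \<le> (2 * real (Suc n)) * (2 * real (Suc n)) ^ i"
    by (intro mult_mono) auto
  then show ?case by (simp add: abs_mult add_ac)
next
  case (4 i n k x)
  have "(2 * real n) ^ i \<le> (2 * real (Suc n)) ^ i"
    by (intro power_mono) auto
  with 4 have "\<bar>Bernstein_deriv i n k x\<bar> \<le> (2 * real (Suc n)) ^ i"
    "\<bar>Bernstein_deriv i n (Suc k) x\<bar> \<le> (2 * real (Suc n)) ^ i"
    by auto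
  then have "\<bar>Bernstein_deriv i n k x - Bernstein_deriv i n (Suc k) x\<bar> \<le> 2 * (2 * real (Suc n)) ^ i"
    by linarith
  then have "real (Suc n) * \<bar>Bernstein_deriv i n k x - Bernstein_deriv i n (Suc k) x\<bar>
     \<le> real (Suc n) * (2 * (2 * real (Suc n)) ^ i)"
    by (rule mult_left_mono) simp
  then show ?case by (simp del: of_nat_Suc add: abs_mult mult_ac)
qed auto

definition binomial_tail :: "nat \<Rightarrow> nat \<Rightarrow> real \<Rightarrow> real" where
  "binomial_tail l k x = (\<Sum>j=k..l. Bernstein l j x)"

lemma prob_binomial_eq_binomial_tail:
  assumes "0 \<le> x" "x \<le> 1"
  shows "measure_pmf.prob (binomial_pmf l x) {k..} = binomial_tail l k x"
proof -
  have "set_pmf (binomial_pmf l x) \<subseteq> {..l}"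
    using assms by (auto simp: set_pmf_binomial_eq)
  then have "measure_pmf.prob (binomial_pmf l x) {k..} = measure_pmf.prob (binomial_pmf l x) {k..l}"
    by (intro measure_pmf.finite_measure_eq_AE) (auto simp: AE_measure_pmf_iff)
  also have "\<dots> = (\<Sum>j=k..l. pmf (binomial_pmf l x) j)"
    by (rule measure_measure_pmf_finite) simp
  also have "\<dots> = binomial_tail l k x"
    using assms by (auto simp: binomial_tail_def Bernstein_def intro!: sum.cong)
  finally show ?thesis .
qed

fun binomial_tail_deriv :: "nat \<Rightarrow> nat \<Rightarrow> nat \<Rightarrow> real \<Rightarrow> real" where
  "binomial_tail_deriv 0 l k x = binomial_tail l k x"
| "binomial_tail_deriv (Suc i) l k x = real l * Bernstein_deriv i (l - 1) (k - 1) x"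

text \<open>
  The derivatives of the summands telescope, and a single Bernstein polynomial remains.
\<close>

lemma has_real_derivative_binomial_tail:
  assumes "k \<ge> 1"
  shows "(binomial_tail l k has_real_derivative real l * Bernstein (l - 1) (k - 1) x) (at x)"
proof (cases l)
  case 0
  have "binomial_tail 0 k = (\<lambda>_. 0)"
    using assms by (simp add: binomial_tail_def fun_eq_iff)
  then show ?thesis using 0 by simp
next
  case l: (Suc n)
  obtain k' where k: "k = Suc k'" using assms by (cases k) auto
  have "(binomial_tail l k has_real_derivative (\<Sum>j=k..l. Bernstein_deriv 1 l j x)) (at x)"
    unfolding binomial_tail_def[abs_def]
    by (intro DERIV_sum has_real_derivative_Bernstein)
  also have "(\<Sum>j=k..l. Bernstein_deriv 1 l j x)
      = real (Suc n) * (\<Sum>j=k'..n. Bernstein n j x - Bernstein n (Suc j) x)"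
    unfolding l k sum.shift_bounds_cl_Suc_ivl by (simp add: sum_distrib_left)
  also have "(\<Sum>j=k'..n. Bernstein n j x - Bernstein n (Suc j) x) = Bernstein n k' x"
  proof (cases "k' \<le> n")
    case True
    have "(\<Sum>j=k'..n. Bernstein n (Suc j) x - Bernstein n j x) = Bernstein n (Suc n) x - Bernstein n k' x"
      by (rule sum_Suc_diff) (use True in simp)
    then have "(\<Sum>j=k'..n. Bernstein n j x - Bernstein n (Suc j) x) = Bernstein n k' x - Bernstein n (Suc n) x"
      by (simp add: sum_subtractf)
    then show ?thesis by (simp add: Bernstein_eq_0)
  qed (simp add: Bernstein_eq_0)
  finally show ?thesis using l k by simp
qed

lemma has_real_derivative_binomial_tail_deriv:
  assumes "k \<ge> 1"
  shows "(binomial_tail_deriv i l k has_real_derivative binomial_tail_deriv (Suc i) l k x) (at x)"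
proof (cases i)
  case 0
  have "binomial_tail_deriv 0 l k = binomial_tail l k" by (simp add: fun_eq_iff)
  then show ?thesis using 0 has_real_derivative_binomial_tail[OF assms] by simp
next
  case (Suc j)
  have "binomial_tail_deriv (Suc j) l k = (\<lambda>x. real l * Bernstein_deriv j (l - 1) (k - 1) x)"
    by (simp add: fun_eq_iff)
  then show ?thesis
    using Suc DERIV_cmult[OF has_real_derivative_Bernstein_deriv[of j "l - 1" "k - 1" x], of "real l"]
    by simp
qed

lemma binomial_tail_bounds:
  assumes "0 \<le> x" "x \<le> 1"
  shows "0 \<le> binomial_tail l k x" "binomial_tail l k x \<le> 1"
  using assms by (simp_all add: prob_binomial_eq_binomial_tail[symmetric])

lemma binomial_tail_deriv_bound:
  assumes "0 \<le> x" "x \<le> 1"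
  shows "\<bar>binomial_tail_deriv i l k x\<bar> \<le> (2 * real l) ^ i"
proof (cases i)
  case 0
  then show ?thesis using binomial_tail_bounds[OF assms, of l k] by simp
next
  case (Suc j)
  have "\<bar>Bernstein_deriv j (l - 1) (k - 1) x\<bar> \<le> (2 * real (l - 1)) ^ j"
    by (rule Bernstein_deriv_bound[OF assms])
  also have "\<dots> \<le> (2 * real l) ^ j"
    by (intro power_mono) auto
  finally have "real l * \<bar>Bernstein_deriv j (l - 1) (k - 1) x\<bar> \<le> (2 * real l) * (2 * real l) ^ j"
    by (intro mult_mono) auto
  then show ?thesis using Suc by (simp add: abs_mult)
qed

lemma binomial_tail_one_one: "binomial_tail 1 1 x = x"
  by (simp add: binomial_tail_def Bernstein_def)

section \<open>Threshold series\<close>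

text \<open>
  Weights are allowed to be negative, so that both the automaton map and its difference from the
  identity are threshold series.
\<close>

definition moments_summable :: "(nat \<Rightarrow> real) \<Rightarrow> bool" where
  "moments_summable w \<longleftrightarrow> (\<forall>p. summable (\<lambda>l. \<bar>w l\<bar> * real l ^ p))"

text \<open>
  The argument \<open>i\<close> is the order of differentiation; order \<open>0\<close> with weights \<open>pmf chi\<close> is the
  automaton map on the unit interval.
\<close>

definition threshold_series :: "(nat \<Rightarrow> nat) \<Rightarrow> (nat \<Rightarrow> real) \<Rightarrow> nat \<Rightarrow> real \<Rightarrow> real" where
  "threshold_series h w i x = (\<Sum>l. w l * binomial_tail_deriv i l (h l) x)"

lemma threshold_series_bound:
  assumes "0 \<le> x" "x \<le> 1"
  shows "norm (w l * binomial_tail_deriv i l k x) \<le> 2 ^ i * (\<bar>w l\<bar> * real l ^ i)"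
  using mult_left_mono[OF binomial_tail_deriv_bound[OF assms, of i l k], of "\<bar>w l\<bar>"]
  by (simp add: abs_mult power_mult_distrib mult_ac)

lemma summable_threshold_series:
  assumes "moments_summable w" "0 \<le> x" "x \<le> 1"
  shows "summable (\<lambda>l. w l * binomial_tail_deriv i l (h l) x)"
  by (rule summable_comparison_test'[where N = 0, OF _ threshold_series_bound[OF assms(2,3)]])
    (use assms(1) in \<open>simp add: moments_summable_def\<close>)

text \<open>
  Termwise differentiation, by the Weierstrass test: the \<open>l\<close>-th term of the differentiated series
  is bounded by a moment term.
\<close>

lemma has_real_derivative_threshold_series:
  assumes w: "moments_summable w" and h: "\<And>l. h l \<ge> 1" and x: "x \<in> {0..1}"
  shows "(threshold_series h w i has_real_derivative threshold_series h w (Suc i) x) (at x within {0..1})"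
proof -
  have "\<exists>g. \<forall>x\<in>{0..1}. (\<lambda>l. w l * binomial_tail_deriv i l (h l) x) sums g x
      \<and> (g has_real_derivative threshold_series h w (Suc i) x) (at x within {0..1})"
  proof (rule has_field_derivative_series[of "{0..1}" "\<lambda>l x. w l * binomial_tail_deriv i l (h l) x"
        "\<lambda>l x. w l * binomial_tail_deriv (Suc i) l (h l) x" "threshold_series h w (Suc i)" 0])
    show "((\<lambda>x. w l * binomial_tail_deriv i l (h l) x) has_real_derivative
        w l * binomial_tail_deriv (Suc i) l (h l) x) (at x within {0..1})" for l x
      by (rule DERIV_cmult, rule has_field_derivative_at_within,
          rule has_real_derivative_binomial_tail_deriv, rule h)
    show "uniform_limit {0..1} (\<lambda>n x. \<Sum>l<n. w l * binomial_tail_deriv (Suc i) l (h l) x)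
       (threshold_series h w (Suc i)) sequentially"
      unfolding threshold_series_def[abs_def]
    proof (rule Weierstrass_m_test)
      show "norm (w l * binomial_tail_deriv (Suc i) l (h l) x) \<le> 2 ^ Suc i * (\<bar>w l\<bar> * real l ^ Suc i)"
        if "x \<in> {0..1}" for l x
        using that by (intro threshold_series_bound) auto
      show "summable (\<lambda>l. 2 ^ Suc i * (\<bar>w l\<bar> * real l ^ Suc i))"
        using w unfolding moments_summable_def by (intro summable_mult) blast
    qed
    show "summable (\<lambda>l. w l * binomial_tail_deriv i l (h l) 0)"
      by (rule summable_threshold_series[OF w]) auto
  qed auto
  then obtain g where g: "\<And>x. x \<in> {0..1} \<Longrightarrow> (\<lambda>l. w l * binomial_tail_deriv i l (h l) x) sums g x"
    "\<And>x. x \<in> {0..1} \<Longrightarrow> (g has_real_derivative threshold_series h w (Suc i) x) (at x within {0..1})"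
    by blast
  have "g y = threshold_series h w i y" if "y \<in> {0..1}" for y
    using sums_unique[OF g(1)[OF that]] by (simp add: threshold_series_def)
  then show ?thesis
    by (intro has_field_derivative_transform_within[OF g(2)[OF x] zero_less_one x])
qed

lemma threshold_series_diff:
  assumes "moments_summable v" "moments_summable w" "0 \<le> x" "x \<le> 1"
  shows "threshold_series h (\<lambda>l. v l - w l) i x = threshold_series h v i x - threshold_series h w i x"
  unfolding threshold_series_def left_diff_distrib
  by (intro suminf_diff[symmetric] summable_threshold_series assms)

lemma moments_summable_finite_support:
  assumes "finite {l. w l \<noteq> 0}"
  shows "moments_summable w"
  unfolding moments_summable_def
  using summable_finite[OF assms, of "\<lambda>l. \<bar>w l\<bar> * real l ^ p" for p] by auto

lemma moments_summable_bounded: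
  assumes "moments_summable v" "\<And>l. \<bar>w l\<bar> \<le> \<bar>v l\<bar>"
  shows "moments_summable w"
  unfolding moments_summable_def
proof
  fix p
  show "summable (\<lambda>l. \<bar>w l\<bar> * real l ^ p)"
    by (rule summable_comparison_test'[where N = 0 and g = "\<lambda>l. \<bar>v l\<bar> * real l ^ p"])
      (use assms in \<open>auto simp: moments_summable_def abs_mult intro!: mult_right_mono\<close>)
qed

lemma moments_summable_diff:
  assumes "moments_summable v" "moments_summable w"
  shows "moments_summable (\<lambda>l. v l - w l)"
  unfolding moments_summable_def
proof
  fix p
  show "summable (\<lambda>l. \<bar>v l - w l\<bar> * real l ^ p)"
  proof (rule summable_comparison_test'[where N = 0])
    show "summable (\<lambda>l. \<bar>v l\<bar> * real l ^ p + \<bar>w l\<bar> * real l ^ p)"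
      using assms by (intro summable_add) (auto simp: moments_summable_def)
    show "norm (\<bar>v l - w l\<bar> * real l ^ p) \<le> \<bar>v l\<bar> * real l ^ p + \<bar>w l\<bar> * real l ^ p" for l
      unfolding distrib_right[symmetric]
      by (simp add: abs_mult) (intro mult_right_mono, auto)
  qed
qed

lemma moments_summable_pmf:
  assumes "all_moments_finite chi"
  shows "moments_summable (pmf chi)"
  unfolding moments_summable_def
proof
  fix p
  have "integrable (measure_pmf chi) (\<lambda>n. real n ^ p)"
    using assms by (simp add: all_moments_finite_def)
  then have "integrable (density (count_space UNIV) (\<lambda>n. ennreal (pmf chi n))) (\<lambda>n. real n ^ p)"
    by (simp add: measure_pmf_eq_density)
  then have "integrable (count_space UNIV) (\<lambda>n. pmf chi n *\<^sub>R real n ^ p)"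
    by (subst (asm) integrable_density) auto
  then show "summable (\<lambda>l. \<bar>pmf chi l\<bar> * real l ^ p)"
    using integrable_count_space_nat_iff[of "\<lambda>n. pmf chi n * real n ^ p"] by simp
qed

lemma unit_interval_deriv_threshold_series:
  assumes w: "moments_summable w" and h: "\<And>l. h l \<ge> 1"
    and f: "\<And>x. x \<in> {0..1} \<Longrightarrow> f x = threshold_series h w 0 x" and x: "x \<in> {0..1}"
  shows "unit_interval_deriv k f x = threshold_series h w k x"
  using x
proof (induction k arbitrary: x)
  case 0
  then show ?case by (simp add: unit_interval_deriv_def f)
next
  case (Suc k)
  have "(unit_interval_deriv k f has_real_derivative threshold_series h w (Suc k) x) (at x within {0..1})"
    by (rule has_field_derivative_transform_within[OF has_real_derivative_threshold_series[OF w h Suc.prems]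
        zero_less_one Suc.prems]) (simp_all only: Suc.IH)
  then have "vector_derivative (unit_interval_deriv k f) (at x within {0..1}) = threshold_series h w (Suc k) x"
    using Suc.prems vector_derivative_within_cbox[of 0 1 x "unit_interval_deriv k f"]
    by (simp add: has_real_derivative_iff_has_vector_derivative)
  then show ?case by (simp add: unit_interval_deriv_def)
qed

section \<open>Order of vanishing at the origin\<close>

text \<open>
  Repeated application of l'Hospital's rule. The one-sided derivatives at \<open>0\<close> thereby turn into
  asymptotic information on \<open>(0, 1)\<close>, where the derivatives are two-sided.
\<close>

lemma tendsto_div_power_at_0:
  fixes D :: "nat \<Rightarrow> real \<Rightarrow> real"
  assumes "\<And>i x. x \<in> {0..1} \<Longrightarrow> (D i has_real_derivative D (Suc i) x) (at x within {0..1})"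
    and "\<And>i. i < n \<Longrightarrow> D i 0 = 0"
  shows "((\<lambda>x. D 0 x / x ^ n) \<longlongrightarrow> D n 0 / fact n) (at_right 0)"
  using assms
proof (induction n arbitrary: D)
  case 0
  have "(D 0 \<longlongrightarrow> D 0 0) (at 0 within {0..1})"
    using 0(1)[of 0 0] by (auto dest!: DERIV_continuous simp: continuous_within)
  then have "(D 0 \<longlongrightarrow> D 0 0) (at_right 0)"
    by (simp add: at_within_Icc_at_right)
  then show ?case by simp
next
  case (Suc n)
  have interior: "(D 0 has_real_derivative D 1 x) (at x)" if "0 < x" "x < 1" for x
    using Suc.prems(1)[of x 0] that at_within_Icc_at[of 0 x 1] by simp
  have ev: "eventually (\<lambda>x::real. 0 < x \<and> x < 1) (at_right 0)"
    unfolding eventually_at_right_field by (intro exI[of _ 1]) auto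
  have lim: "((\<lambda>x. D 1 x / x ^ n) \<longlongrightarrow> D (Suc n) 0 / fact n) (at_right 0)"
    using Suc.IH[of "\<lambda>i. D (Suc i)"] Suc.prems by simp
  show ?case
  proof (rule lhopital_right_0)
    have "(D 0 \<longlongrightarrow> D 0 0) (at 0 within {0..1})"
      using Suc.prems(1)[of 0 0] by (auto dest!: DERIV_continuous simp: continuous_within)
    then show "(D 0 \<longlongrightarrow> 0) (at_right 0)"
      using Suc.prems(2)[of 0] by (simp add: at_within_Icc_at_right)
    show "((\<lambda>x::real. x ^ Suc n) \<longlongrightarrow> 0) (at_right 0)"
      by (rule tendsto_eq_intros refl | simp)+
    show "eventually (\<lambda>x::real. x ^ Suc n \<noteq> 0) (at_right 0)"
      using ev by eventually_elim simp
    show "eventually (\<lambda>x::real. real (Suc n) * x ^ n \<noteq> 0) (at_right 0)"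
      using ev by eventually_elim (simp del: of_nat_Suc)
    show "eventually (\<lambda>x. (D 0 has_real_derivative D 1 x) (at x)) (at_right 0)"
      using ev by eventually_elim (use interior in blast)
    show "eventually (\<lambda>x. ((\<lambda>x. x ^ Suc n) has_real_derivative real (Suc n) * x ^ n) (at x)) (at_right 0)"
      by (intro always_eventually allI) (rule derivative_eq_intros refl | simp)+
    have "((\<lambda>x. D 1 x / x ^ n / real (Suc n)) \<longlongrightarrow> D (Suc n) 0 / fact n / real (Suc n)) (at_right 0)"
      by (intro tendsto_divide lim tendsto_const) simp
    then show "((\<lambda>x. D 1 x / (real (Suc n) * x ^ n)) \<longlongrightarrow> D (Suc n) 0 / fact (Suc n)) (at_right 0)"
      by (simp del: of_nat_Suc add: mult_ac)
  qed
qed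

text \<open>
  A crude union bound: at least \<open>j\<close> successes are needed, and there are at most \<open>n ^ j\<close> ways to
  choose them.
\<close>

lemma Bernstein_le_power:
  assumes "0 \<le> x" "x \<le> 1" "j \<le> i"
  shows "Bernstein n i x \<le> (real n * x) ^ j"
  using assms(3)
proof (induction j arbitrary: n i)
  case 0
  then show ?case using Bernstein_le_1[OF assms(1,2)] by simp
next
  case (Suc j)
  obtain i' where i: "i = Suc i'" using Suc.prems by (cases i) auto
  show ?case
  proof (cases n)
    case 0
    then show ?thesis using i by (simp add: Bernstein_eq_0)
  next
    case n: (Suc n')
    have "Suc i' * (Suc n' choose Suc i') = Suc n' * (n' choose i')"
      using Suc_times_binomial_eq[of n' i'] by (simp only: mult.commute)
    then have "(Suc n' choose Suc i') \<le> Suc n' * (n' choose i')"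
      by (metis le_add1 mult_Suc)
    then have "real (Suc n' choose Suc i') \<le> real (Suc n') * real (n' choose i')"
      by (metis of_nat_le_iff of_nat_mult)
    then have "real (Suc n' choose Suc i') * (x ^ Suc i' * (1 - x) ^ (n' - i'))
        \<le> real (Suc n') * real (n' choose i') * (x ^ Suc i' * (1 - x) ^ (n' - i'))"
      using assms(1,2) by (intro mult_right_mono) auto
    then have "Bernstein n i x \<le> (real n * x) * Bernstein n' i' x"
      unfolding n i Bernstein_def diff_Suc_Suc power_Suc by (simp only: mult_ac)
    also have "\<dots> \<le> (real n * x) * (real n' * x) ^ j"
      using Suc i assms by (intro mult_left_mono) auto
    also have "\<dots> \<le> (real n * x) * (real n * x) ^ j"
      using n assms by (intro mult_left_mono power_mono mult_right_mono) auto
    finally show ?thesis by simp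
  qed
qed

text \<open>
  Vertices with threshold above \<open>j\<close> contribute only at order \<open>x ^ j\<close> to the derivative. This
  makes it possible to discard high thresholds in all statements about low-order behaviour at \<open>0\<close>.
\<close>

lemma threshold_series_deriv_bound:
  assumes w: "moments_summable w" and high: "\<And>l. w l \<noteq> 0 \<Longrightarrow> j < h l"
  obtains C where "C \<ge> 0"
    "\<And>x. 0 \<le> x \<Longrightarrow> x \<le> 1 \<Longrightarrow> \<bar>threshold_series h w 1 x\<bar> \<le> C * x ^ j"
proof
  define C where "C = (\<Sum>l. \<bar>w l\<bar> * real l ^ Suc j)"
  have sm: "summable (\<lambda>l. \<bar>w l\<bar> * real l ^ Suc j)"
    using w unfolding moments_summable_def by blast
  show "C \<ge> 0"
    unfolding C_def by (intro suminf_nonneg sm) auto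
  fix x :: real
  assume x: "0 \<le> x" "x \<le> 1"
  have bound: "norm (w l * binomial_tail_deriv 1 l (h l) x) \<le> \<bar>w l\<bar> * real l ^ Suc j * x ^ j" for l
  proof (cases "w l = 0")
    case False
    then have "j \<le> h l - 1" using high[of l] by simp
    then have "Bernstein (l - 1) (h l - 1) x \<le> (real (l - 1) * x) ^ j"
      by (rule Bernstein_le_power[OF x])
    also have "\<dots> \<le> (real l * x) ^ j"
      using x by (intro power_mono mult_right_mono) auto
    finally have "real l * Bernstein (l - 1) (h l - 1) x \<le> real l * (real l * x) ^ j"
      by (intro mult_left_mono) auto
    then have "\<bar>w l\<bar> * (real l * Bernstein (l - 1) (h l - 1) x) \<le> \<bar>w l\<bar> * (real l * (real l * x) ^ j)"
      by (rule mult_left_mono) simp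
    also have "\<bar>w l\<bar> * (real l * Bernstein (l - 1) (h l - 1) x) = norm (w l * binomial_tail_deriv 1 l (h l) x)"
      using x by (simp add: abs_mult Bernstein_nonneg)
    also have "\<bar>w l\<bar> * (real l * (real l * x) ^ j) = \<bar>w l\<bar> * real l ^ Suc j * x ^ j"
      by (simp add: power_mult_distrib)
    finally show ?thesis .
  qed simp
  have sm': "summable (\<lambda>l. \<bar>w l\<bar> * real l ^ Suc j * x ^ j)"
    by (intro summable_mult2 sm)
  have "norm (threshold_series h w 1 x) \<le> (\<Sum>l. \<bar>w l\<bar> * real l ^ Suc j * x ^ j)"
    unfolding threshold_series_def
    by (rule norm_suminf_le[OF bound sm'])
  also have "\<dots> = C * x ^ j"
    unfolding C_def by (intro suminf_mult2[symmetric] sm)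
  finally show "\<bar>threshold_series h w 1 x\<bar> \<le> C * x ^ j" by simp
qed

section \<open>Coefficient sequences with one sign change\<close>

text \<open>
  Nonpositive coefficients followed by nonnegative ones. The strict sign of the first coefficient
  keeps the sequence from degenerating to zero when it is divided.
\<close>

definition sign_changing :: "(nat \<Rightarrow> real) \<Rightarrow> bool" where
  "sign_changing c \<longleftrightarrow> c 0 < 0 \<and> (\<exists>d. (\<forall>i<d. c i \<le> 0) \<and> (\<forall>i\<ge>d. c i \<ge> 0))"

text \<open>
  Dividing by \<open>1 - y\<close> replaces the coefficients by their partial sums. These first decrease from
  a negative value and then increase to their limit \<open>poly r 1 = 0\<close>, so they are all nonpositive.
  Hence any nonnegative coefficients may be placed above them without a second sign change.
\<close>

lemma sign_changing_poly_divide: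
  fixes r :: "real poly"
  assumes sc: "sign_changing (coeff r)" and root: "poly r 1 = 0"
  obtains N where "r = [:1, -1:] * N" "sign_changing (coeff N)"
    "\<And>b. (\<forall>i>b. coeff r i = 0) \<Longrightarrow> (\<forall>i\<ge>b. coeff N i = 0)"
proof -
  have "[:-1, 1:] dvd r" using root by (simp add: poly_eq_0_iff_dvd)
  then obtain N' where "r = [:-1, 1:] * N'" by (elim dvdE)
  then have r: "r = [:1, -1:] * (- N')" by simp
  define N where "N = - N'"
  have rN: "r = [:1, -1:] * N" using r N_def by simp
  have c0: "coeff N 0 = coeff r 0" by (simp add: rN)
  have cS: "coeff N (Suc i) = coeff N i + coeff r (Suc i)" for i
    by (simp add: rN)
  obtain d where d: "\<And>i. i < d \<Longrightarrow> coeff r i \<le> 0" "\<And>i. i \<ge> d \<Longrightarrow> coeff r i \<ge> 0"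
    and r0: "coeff r 0 < 0"
    using sc by (auto simp: sign_changing_def)
  have eventually_0: "coeff N (i + n) = 0" if "n > degree N" for i n
    using that by (intro coeff_eq_0) auto
  have low: "coeff N i \<le> 0" if "i < d" for i
    using that
  proof (induction i)
    case (Suc i)
    then show ?case using cS[of i] d(1)[of "Suc i"] by simp
  qed (use c0 r0 in simp)
  have up: "coeff N i \<le> coeff N (i + n)" if "i \<ge> d" for i n
  proof (induction n)
    case (Suc n)
    then show ?case using cS[of "i + n"] d(2)[of "Suc (i + n)"] that by simp
  qed simp
  have nonpos: "coeff N i \<le> 0" for i
  proof (cases "i < d")
    case False
    then show ?thesis
      using up[of i "Suc (degree N)"] eventually_0[of "Suc (degree N)" i] by simp
  qed (rule low)
  have "sign_changing (coeff N)"
    unfolding sign_changing_def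
    using c0 r0 nonpos by (auto intro!: exI[of _ "Suc (degree N)"] simp: coeff_eq_0)
  moreover have "\<forall>i\<ge>b. coeff N i = 0" if b: "\<forall>i>b. coeff r i = 0" for b
  proof (intro allI impI)
    fix i assume "b \<le> i"
    have "coeff N (i + n) = coeff N i" for n
    proof (induction n)
      case (Suc n)
      then show ?case using cS[of "i + n"] b \<open>b \<le> i\<close> by simp
    qed simp
    from this[of "Suc (degree N)"] show "coeff N i = 0"
      using eventually_0[of "Suc (degree N)" i] by simp
  qed
  ultimately show ?thesis using that rN by blast
qed

text \<open>
  For \<open>y > 0\<close>, a monomial \<open>c * y ^ i / y ^ d\<close> with the sign of \<open>c\<close> as here is nondecreasing in
  \<open>y\<close>. The inequality is this monotonicity with the denominators cleared, a form in which it can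
  be summed over \<open>i\<close>.
\<close>

lemma cross_inequality_term:
  fixes c y\<^sub>1 y\<^sub>2 :: real
  assumes "0 < y\<^sub>1" "y\<^sub>1 < y\<^sub>2" and sgn: "i < d \<Longrightarrow> c \<le> 0" "i \<ge> d \<Longrightarrow> c \<ge> 0"
  shows "c * y\<^sub>1 ^ i * y\<^sub>2 ^ d \<le> c * y\<^sub>2 ^ i * y\<^sub>1 ^ d"
proof (cases "i < d")
  case True
  then obtain e where e: "d = i + e" by (metis less_imp_add_positive)
  have "(y\<^sub>1 * y\<^sub>2) ^ i * y\<^sub>1 ^ e \<le> (y\<^sub>1 * y\<^sub>2) ^ i * y\<^sub>2 ^ e"
    using assms(1,2) by (intro mult_left_mono power_mono) auto
  then have "y\<^sub>2 ^ i * y\<^sub>1 ^ d \<le> y\<^sub>1 ^ i * y\<^sub>2 ^ d"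
    by (simp only: e power_add power_mult_distrib mult_ac)
  then show ?thesis
    using sgn(1)[OF True] by (simp add: mult.assoc mult_left_mono_neg)
next
  case False
  then obtain e where e: "i = d + e" by (metis le_iff_add not_less)
  have "(y\<^sub>1 * y\<^sub>2) ^ d * y\<^sub>1 ^ e \<le> (y\<^sub>1 * y\<^sub>2) ^ d * y\<^sub>2 ^ e"
    using assms(1,2) by (intro mult_left_mono power_mono) auto
  then have "y\<^sub>1 ^ i * y\<^sub>2 ^ d \<le> y\<^sub>2 ^ i * y\<^sub>1 ^ d"
    by (simp only: e power_add power_mult_distrib mult_ac)
  then show ?thesis
    using sgn(2) False by (simp add: mult.assoc mult_left_mono)
qed

lemma cross_inequality_poly:
  fixes r :: "real poly" and y\<^sub>1 y\<^sub>2 :: real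
  assumes "0 < y\<^sub>1" "y\<^sub>1 < y\<^sub>2"
    and "\<And>i. i < d \<Longrightarrow> coeff r i \<le> 0" "\<And>i. i \<ge> d \<Longrightarrow> coeff r i \<ge> 0"
  shows "poly r y\<^sub>1 * y\<^sub>2 ^ d \<le> poly r y\<^sub>2 * y\<^sub>1 ^ d"
  unfolding poly_altdef sum_distrib_right
  by (intro sum_mono cross_inequality_term assms)

section \<open>Single crossing for concordant weights\<close>

lemma threshold_series_finite:
  assumes "\<And>l. l > L \<Longrightarrow> w l = 0"
  shows "threshold_series h w i x = (\<Sum>l\<le>L. w l * binomial_tail_deriv i l (h l) x)"
  unfolding threshold_series_def using assms by (intro suminf_finite) auto

text \<open>
  In the application \<open>u\<close> is the child distribution minus the point mass at \<open>1\<close>. As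
  \<open>h 1 = 1\<close>, the threshold series of this point mass is the identity, so the series of \<open>u\<close> is
  the automaton map minus the identity, and \<open>flat\<close> and \<open>rising\<close> express supercordance.
\<close>

locale concordant_weights =
  fixes h :: "nat \<Rightarrow> nat" and u :: "nat \<Rightarrow> real" and m :: nat
  assumes h_pos: "\<And>l. h l \<ge> 1" and h_mono: "mono h" and h_1: "h 1 = 1"
    and u_moments: "moments_summable u"
    and u_neg: "u 1 < 0" and u_nonneg: "\<And>l. l \<noteq> 1 \<Longrightarrow> u l \<ge> 0"
    and m_pos: "m \<ge> 1"
    and flat: "\<And>i. 1 \<le> i \<Longrightarrow> i < m \<Longrightarrow> threshold_series h u i 0 = 0"
    and rising: "threshold_series h u m 0 > 0"
begin

definition partial_deriv :: "nat \<Rightarrow> real \<Rightarrow> real" where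
  "partial_deriv L x = (\<Sum>l\<le>L. u l * (real l * Bernstein (l - 1) (h l - 1) x))"

text \<open>
  The inductive invariant of the single crossing argument: the partial sum contains the factor
  \<open>x ^ (k - 1)\<close>, and the cofactor, as a polynomial in \<open>1 - x\<close>, has one sign change. The degree
  condition says that a next term of threshold \<open>k\<close>, a multiple of
  \<open>x ^ (k - 1) * (1 - x) ^ (Suc L - k)\<close>, lies above all present coefficients.
\<close>

definition factored :: "nat \<Rightarrow> nat \<Rightarrow> bool" where
  "factored L k \<longleftrightarrow> (\<exists>r::real poly. (\<forall>x. partial_deriv L x = x ^ (k - 1) * poly r (1 - x))
     \<and> sign_changing (coeff r) \<and> (\<forall>i. L < i + k \<longrightarrow> coeff r i = 0))"

lemma factored_1: "factored 1 1"
  unfolding factored_def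
proof (intro exI[of _ "[:u 1:]"] conjI allI impI)
  have "{..1::nat} = {0, 1}" by auto
  then show "partial_deriv 1 x = x ^ (1 - 1) * poly [:u 1:] (1 - x)" for x
    using h_1 by (simp add: partial_deriv_def Bernstein_def)
  show "sign_changing (coeff [:u 1:])"
    using u_neg by (auto simp: sign_changing_def coeff_pCons intro!: exI[of _ 1] split: nat.splits)
  show "1 < i + 1 \<Longrightarrow> coeff [:u 1:] i = 0" for i
    by (cases i) auto
qed

text \<open>
  If the threshold does not jump, the new term is a single nonnegative coefficient above the
  previous ones.
\<close>

lemma factored_extend:
  assumes f: "factored L k" and k: "h (Suc L) = k" and L: "L \<ge> 1"
  shows "factored (Suc L) k"
proof -
  obtain r :: "real poly" where r: "\<And>x. partial_deriv L x = x ^ (k - 1) * poly r (1 - x)"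
    "sign_changing (coeff r)" "\<And>i. L < i + k \<Longrightarrow> coeff r i = 0"
    using f by (auto simp: factored_def)
  define a where "a = u (Suc L) * real (Suc L) * real (L choose (k - 1))"
  have a: "a \<ge> 0" unfolding a_def using u_nonneg[of "Suc L"] L by simp
  have kL: "k \<le> L" using r(2,3) unfolding sign_changing_def by force
  have k1: "k \<ge> 1" using h_pos k by metis
  define r' where "r' = r + monom a (Suc L - k)"
  have c': "coeff r' i = coeff r i + (if i = Suc L - k then a else 0)" for i
    by (simp add: r'_def)
  obtain d where d: "\<And>i. i < d \<Longrightarrow> coeff r i \<le> 0" "\<And>i. i \<ge> d \<Longrightarrow> coeff r i \<ge> 0"
    using r(2) by (auto simp: sign_changing_def)
  show ?thesis
    unfolding factored_def
  proof (intro exI[of _ r'] conjI allI impI)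
    have e: "L - (k - Suc 0) = Suc L - k" using k1 by simp
    show "partial_deriv (Suc L) x = x ^ (k - 1) * poly r' (1 - x)" for x
      using r(1)[of x] k
      by (simp add: partial_deriv_def Bernstein_def r'_def poly_monom a_def e distrib_left mult_ac
          del: of_nat_Suc)
    show "sign_changing (coeff r')"
      unfolding sign_changing_def
    proof (intro conjI exI[of _ "min d (Suc L - k)"] allI impI)
      show "coeff r' 0 < 0"
        using r(2) kL by (simp add: c' sign_changing_def)
      show "i < min d (Suc L - k) \<Longrightarrow> coeff r' i \<le> 0" for i
        using d(1)[of i] by (simp add: c')
      show "coeff r' i \<ge> 0" if "min d (Suc L - k) \<le> i" for i
        using that d(2)[of i] r(3)[of i] a by (cases "d \<le> i") (auto simp: c')
    qed
    show "coeff r' i = 0" if "Suc L < i + k" for i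
      using r(3)[of i] that kL by (auto simp: c')
  qed
qed

lemma tendsto_div_power_of_high_weights:
  assumes w: "moments_summable w" and high: "\<And>l. w l \<noteq> 0 \<Longrightarrow> Suc n < h l"
  shows "((\<lambda>x. threshold_series h w 1 x / x ^ n) \<longlongrightarrow> 0) (at_right 0)"
proof -
  obtain C where C: "C \<ge> 0" "\<And>x. 0 \<le> x \<Longrightarrow> x \<le> 1 \<Longrightarrow> \<bar>threshold_series h w 1 x\<bar> \<le> C * x ^ Suc n"
    using threshold_series_deriv_bound[of w "Suc n" h, OF w high] by blast
  have ev: "eventually (\<lambda>x::real. 0 < x \<and> x < 1) (at_right 0)"
    unfolding eventually_at_right_field by (intro exI[of _ 1]) auto
  show ?thesis
  proof (rule Lim_null_comparison)
    show "eventually (\<lambda>x. norm (threshold_series h w 1 x / x ^ n) \<le> C * x) (at_right 0)"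
      using ev
    proof eventually_elim
      case (elim x)
      then show ?case
        using C(2)[of x] by (simp add: field_simps)
    qed
    show "((\<lambda>x. C * x) \<longlongrightarrow> 0) (at_right 0)"
      by (rule tendsto_eq_intros refl | simp)+
  qed
qed

lemma tendsto_deriv_div_power:
  assumes "n < m"
  shows "((\<lambda>x. threshold_series h u 1 x / x ^ n) \<longlongrightarrow> threshold_series h u (Suc n) 0 / fact n) (at_right 0)"
proof -
  have "((\<lambda>x. (\<lambda>i. threshold_series h u (Suc i)) 0 x / x ^ n) \<longlongrightarrow>
      (\<lambda>i. threshold_series h u (Suc i)) n 0 / fact n) (at_right 0)"
    by (rule tendsto_div_power_at_0)
      (use assms flat in \<open>auto intro: has_real_derivative_threshold_series[OF u_moments h_pos]\<close>)
  then show ?thesis by simp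
qed

text \<open>
  If the threshold jumps above \<open>k\<close>, all later terms are of order \<open>x ^ k\<close>, while for \<open>k < m\<close> the
  whole series vanishes to that order by concordance. So the cofactor of the partial sum vanishes
  at \<open>x = 0\<close>, and a further factor \<open>x\<close> can be divided out. This is where concordance enters, and
  where monotonicity of \<open>h\<close> is essential.
\<close>

lemma factored_next:
  assumes f: "factored L k" and k: "h L \<le> k" "k < h (Suc L)" "k < m"
  shows "factored L (Suc k)"
proof -
  obtain r :: "real poly" where r: "\<And>x. partial_deriv L x = x ^ (k - 1) * poly r (1 - x)"
    "sign_changing (coeff r)" "\<And>i. L < i + k \<Longrightarrow> coeff r i = 0"
    using f by (auto simp: factored_def)
  have k1: "k \<ge> 1" using h_pos[of L] k by simp
  define v where "v = (\<lambda>l. if l \<le> L then u l else 0)"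
  have v: "moments_summable v" "moments_summable (\<lambda>l. u l - v l)"
    by (rule moments_summable_bounded[OF u_moments]; simp add: v_def)+
  have "threshold_series h v 1 x = partial_deriv L x" for x
    unfolding partial_deriv_def
    by (subst threshold_series_finite[of L]) (auto simp: v_def intro!: sum.cong)
  then have split: "partial_deriv L x = threshold_series h u 1 x - threshold_series h (\<lambda>l. u l - v l) 1 x"
    if "0 \<le> x" "x \<le> 1" for x
    using threshold_series_diff[OF u_moments v(1) that, of h 1] by simp
  have ev: "eventually (\<lambda>x::real. 0 < x \<and> x < 1) (at_right 0)"
    unfolding eventually_at_right_field by (intro exI[of _ 1]) auto
  \<comment> \<open>The cofactor is the quotient of the whole series by \<open>x ^ (k - 1)\<close> minus that of the later terms,
    and both quotients tend to zero.\<close>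
  have "((\<lambda>x. threshold_series h u 1 x / x ^ (k - 1) - threshold_series h (\<lambda>l. u l - v l) 1 x / x ^ (k - 1))
      \<longlongrightarrow> threshold_series h u (Suc (k - 1)) 0 / fact (k - 1) - 0) (at_right 0)"
  proof (intro tendsto_diff tendsto_deriv_div_power tendsto_div_power_of_high_weights v)
    show "k - 1 < m" using k by simp
    fix l assume "u l - v l \<noteq> 0"
    then have "Suc L \<le> l" by (auto simp: v_def split: if_splits)
    then have "h (Suc L) \<le> h l" using h_mono by (simp add: monoD)
    then show "Suc (k - 1) < h l" using k k1 by simp
  qed
  moreover have "eventually (\<lambda>x. threshold_series h u 1 x / x ^ (k - 1)
      - threshold_series h (\<lambda>l. u l - v l) 1 x / x ^ (k - 1) = poly r (1 - x)) (at_right 0)"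
    using ev
  proof eventually_elim
    case (elim x)
    then have "threshold_series h u 1 x - threshold_series h (\<lambda>l. u l - v l) 1 x
        = x ^ (k - 1) * poly r (1 - x)"
      using split[of x] r(1)[of x] by simp
    then show ?case
      using elim unfolding diff_divide_distrib[symmetric] by simp
  qed
  ultimately have "((\<lambda>x. poly r (1 - x)) \<longlongrightarrow> 0) (at_right 0)"
    using flat[of k] k k1 by (simp add: tendsto_cong)
  moreover have "((\<lambda>x. poly r (1 - x)) \<longlongrightarrow> poly r (1 - 0)) (at_right 0)"
    by (intro tendsto_poly tendsto_intros)
  ultimately have "poly r 1 = 0"
    using tendsto_unique[of "at_right (0::real)"] by (force simp: trivial_limit_at_right_real)
  then obtain N where N: "r = [:1, -1:] * N" "sign_changing (coeff N)"
    "\<And>b. (\<forall>i>b. coeff r i = 0) \<Longrightarrow> (\<forall>i\<ge>b. coeff N i = 0)"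
    using sign_changing_poly_divide[OF r(2)] by blast
  have kL: "k \<le> L" using r(2,3) unfolding sign_changing_def by force
  have "\<forall>i\<ge>L - k. coeff N i = 0"
    by (rule N(3)) (use r(3) kL in auto)
  then have "\<forall>i. L < i + Suc k \<longrightarrow> coeff N i = 0"
    by auto
  moreover have "x ^ (k - 1) * poly r (1 - x) = x ^ (Suc k - 1) * poly N (1 - x)" for x
    unfolding N(1) using k1 by (cases k) (auto simp: algebra_simps)
  ultimately show ?thesis
    unfolding factored_def using N(2) r(1) by auto
qed

lemma factored_threshold:
  assumes "L \<ge> 1" "h L \<le> m"
  shows "factored L (h L)"
  using assms
proof (induction L rule: nat_induct_at_least)
  case base
  show ?case unfolding h_1 by (rule factored_1)
next
  case (Suc L)
  have le: "h L \<le> h (Suc L)" using h_mono by (simp add: monoD)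
  have "factored L k" if "h L \<le> k" "k \<le> h (Suc L)" for k
    using that
  proof (induction k rule: dec_induct)
    case base
    then show ?case using Suc le by simp
  next
    case (step k)
    then show ?case using factored_next[of L k] Suc.prems by simp
  qed
  from this[of "h (Suc L)"] show ?case
    using factored_extend[of L] le Suc.hyps by simp
qed

definition low_weights :: "nat \<Rightarrow> real" where
  "low_weights l = (if h l \<le> m then u l else 0)"

lemma moments_summable_low_weights: "moments_summable low_weights"
  by (rule moments_summable_bounded[OF u_moments]) (simp add: low_weights_def)

lemma low_deriv_eventually_positive:
  obtains \<delta> where "0 < \<delta>" "\<delta> \<le> 1" "\<And>x. 0 < x \<Longrightarrow> x < \<delta> \<Longrightarrow> threshold_series h low_weights 1 x > 0"
proof -
  define v where "v = (\<lambda>l. u l - low_weights l)"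
  have v: "moments_summable v"
    by (rule moments_summable_bounded[OF u_moments]) (simp add: low_weights_def v_def)
  have ev: "eventually (\<lambda>x::real. 0 < x \<and> x < 1) (at_right 0)"
    unfolding eventually_at_right_field by (intro exI[of _ 1]) auto
  have "((\<lambda>x. threshold_series h u 1 x / x ^ (m - 1) - threshold_series h v 1 x / x ^ (m - 1))
      \<longlongrightarrow> threshold_series h u (Suc (m - 1)) 0 / fact (m - 1) - 0) (at_right 0)"
    by (intro tendsto_diff tendsto_deriv_div_power tendsto_div_power_of_high_weights v)
      (use m_pos in \<open>auto simp: v_def low_weights_def split: if_splits\<close>)
  moreover have "threshold_series h u (Suc (m - 1)) 0 / fact (m - 1) - 0 > 0"
    using rising m_pos by simp
  ultimately have "eventually (\<lambda>x. threshold_series h u 1 x / x ^ (m - 1) - threshold_series h v 1 x / x ^ (m - 1) > 0) (at_right 0)"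
    by (rule order_tendstoD(1))
  then have "eventually (\<lambda>x. threshold_series h low_weights 1 x > 0) (at_right 0)"
    using ev
  proof eventually_elim
    case (elim x)
    have "threshold_series h v 1 x = threshold_series h u 1 x - threshold_series h low_weights 1 x"
      unfolding v_def using elim
      by (intro threshold_series_diff[OF u_moments moments_summable_low_weights]) auto
    then show ?case
      using elim by (simp add: diff_divide_distrib[symmetric] zero_less_divide_iff)
  qed
  then obtain b where "b > 0" "\<And>x. 0 < x \<Longrightarrow> x < b \<Longrightarrow> threshold_series h low_weights 1 x > 0"
    unfolding eventually_at_right_field by auto
  then show ?thesis by (intro that[of "min b 1"]) auto
qed

text \<open>
  The single crossing property: up to the positive factor \<open>x ^ k * (1 - x) ^ d\<close>, the derivative is
  nonincreasing in \<open>x\<close>. If some threshold exceeds \<open>m\<close>, the low part of the series is a finite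
  partial sum. Otherwise \<open>h\<close> is eventually constant, and the remaining terms form a power series
  in \<open>1 - x\<close> with nonnegative coefficients above those of a partial sum.
\<close>

lemma low_deriv_factorization:
  obtains k d and G :: "real \<Rightarrow> real" where
    "\<And>x. 0 < x \<Longrightarrow> x < 1 \<Longrightarrow> threshold_series h low_weights 1 x = x ^ k * G (1 - x)"
    "\<And>y\<^sub>1 y\<^sub>2. 0 < y\<^sub>1 \<Longrightarrow> y\<^sub>1 < y\<^sub>2 \<Longrightarrow> y\<^sub>2 < 1 \<Longrightarrow> G y\<^sub>1 * y\<^sub>2 ^ d \<le> G y\<^sub>2 * y\<^sub>1 ^ d"
proof (cases "\<exists>l. m < h l")
  case True
  define M where "M = (LEAST l. m < h l)"
  have M: "m < h M" "\<And>l. l < M \<Longrightarrow> h l \<le> m"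
    unfolding M_def by (rule LeastI_ex[OF True]) (drule not_less_Least, simp)
  have "2 \<le> M"
  proof (rule ccontr)
    assume "\<not> 2 \<le> M"
    then have "h M \<le> h 1" using h_mono by (simp add: monoD)
    then show False using M(1) h_1 m_pos by simp
  qed
  then obtain L where L: "M = Suc L" "L \<ge> 1" by (cases M) auto
  have "h L \<le> m" using M L by simp
  from factored_threshold[OF L(2) this]
  obtain r :: "real poly" where r: "\<And>x. partial_deriv L x = x ^ (h L - 1) * poly r (1 - x)"
    "sign_changing (coeff r)"
    by (auto simp: factored_def)
  obtain d where d: "\<And>i. i < d \<Longrightarrow> coeff r i \<le> 0" "\<And>i. i \<ge> d \<Longrightarrow> coeff r i \<ge> 0"
    using r(2) by (auto simp: sign_changing_def)
  have high: "low_weights l = 0" if "L < l" for l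
  proof -
    have "h M \<le> h l" using that h_mono L by (simp add: monoD)
    then show ?thesis using M(1) by (simp add: low_weights_def)
  qed
  have low: "low_weights l = u l" if "l \<le> L" for l
    using M(2)[of l] that L by (simp add: low_weights_def)
  have "threshold_series h low_weights 1 x = partial_deriv L x" for x
  proof -
    have "threshold_series h low_weights 1 x = (\<Sum>l\<le>L. low_weights l * binomial_tail_deriv 1 l (h l) x)"
      by (rule threshold_series_finite) (rule high)
    also have "\<dots> = partial_deriv L x"
      unfolding partial_deriv_def by (intro sum.cong) (auto simp: low)
    finally show ?thesis .
  qed
  then show ?thesis
    by (intro that[of "h L - 1" "poly r" d] cross_inequality_poly d) (use r(1) in auto)
next
  case False
  then have bounded: "h l \<le> m" for l by (simp add: not_less)
  define k where "k = Max (range h)"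
  have fin: "finite (range h)"
    by (rule finite_subset[of _ "{..m}"]) (use bounded in auto)
  then have "k \<in> range h" unfolding k_def by (intro Max_in) auto
  then obtain L' where L': "h L' = k" by auto
  define L where "L = max 1 L'"
  have k: "h l = k" if "l \<ge> L" for l
  proof (rule antisym)
    show "h l \<le> k" unfolding k_def using fin by simp
    have "L' \<le> l" using that by (simp add: L_def)
    then show "k \<le> h l" using h_mono L' by (auto simp: monoD)
  qed
  have L1: "L \<ge> 1" by (simp add: L_def)
  from factored_threshold[OF L1 bounded] k[of L]
  obtain r :: "real poly" where r: "\<And>x. partial_deriv L x = x ^ (k - 1) * poly r (1 - x)"
    "sign_changing (coeff r)" "\<And>i. L < i + k \<Longrightarrow> coeff r i = 0"
    by (auto simp: factored_def)
  obtain d where d: "\<And>i. i < d \<Longrightarrow> coeff r i \<le> 0" "\<And>i. i \<ge> d \<Longrightarrow> coeff r i \<ge> 0"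
    using r(2) by (auto simp: sign_changing_def)
  have kL: "k \<le> L" using r(2,3) unfolding sign_changing_def by force
  have k1: "k \<ge> 1" using h_pos[of L] k[of L] by simp
  define a where "a l = (if L < l then u l * (real l * real ((l - 1) choose (k - 1))) else 0)" for l
  have a: "a l \<ge> 0" for l
    using u_nonneg[of l] L1 by (auto simp: a_def)
  \<comment> \<open>The series starts at exponent \<open>Suc L - k\<close>, above all coefficients of \<open>r\<close>. Lowering \<open>d\<close> to this
    exponent puts all of its terms on the nonnegative side without affecting \<open>r\<close>.\<close>
  define d' where "d' = min d (Suc L - k)"
  define G where "G y = poly r y + (\<Sum>l. a l * y ^ (l - k))" for y
  have remainder: "u l * binomial_tail_deriv 1 l (h l) x - (if l \<le> L then u l * binomial_tail_deriv 1 l (h l) x else 0)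
      = x ^ (k - 1) * (a l * (1 - x) ^ (l - k))" for l x
    using k[of l] k1 by (auto simp: a_def Bernstein_def Suc_diff_le)
  have sm: "summable (\<lambda>l. a l * (1 - x) ^ (l - k))" if "0 < x" "x < 1" for x
  proof -
    have "summable (\<lambda>l. u l * binomial_tail_deriv 1 l (h l) x - (if l \<le> L then u l * binomial_tail_deriv 1 l (h l) x else 0))"
      using that by (intro summable_diff summable_threshold_series[OF u_moments] summable_If_finite) auto
    then have "summable (\<lambda>l. x ^ (k - 1) * (a l * (1 - x) ^ (l - k)))"
      by (simp only: remainder)
    then show ?thesis using that by (simp add: summable_cmult_iff)
  qed
  have lw: "low_weights = u"
    using bounded by (auto simp: low_weights_def)
  show ?thesis
  proof (rule that[of "k - 1" G d'])
    fix x :: real assume x: "0 < x" "x < 1"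
    have "threshold_series h u 1 x - partial_deriv L x
        = (\<Sum>l. u l * binomial_tail_deriv 1 l (h l) x) - (\<Sum>l. if l \<le> L then u l * binomial_tail_deriv 1 l (h l) x else 0)"
      unfolding threshold_series_def partial_deriv_def
      by (subst suminf_finite[of "{..L}" "\<lambda>l. if l \<le> L then _ l else 0"]) auto
    also have "\<dots> = (\<Sum>l. x ^ (k - 1) * (a l * (1 - x) ^ (l - k)))"
      unfolding remainder[symmetric]
      using x by (intro suminf_diff summable_threshold_series[OF u_moments] summable_If_finite) auto
    also have "\<dots> = x ^ (k - 1) * (\<Sum>l. a l * (1 - x) ^ (l - k))"
      by (intro suminf_mult sm x)
    finally show "threshold_series h low_weights 1 x = x ^ (k - 1) * G (1 - x)"
      by (simp add: lw r(1) G_def distrib_left)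
  next
    fix y\<^sub>1 y\<^sub>2 :: real assume y: "0 < y\<^sub>1" "y\<^sub>1 < y\<^sub>2" "y\<^sub>2 < 1"
    have "poly r y\<^sub>1 * y\<^sub>2 ^ d' \<le> poly r y\<^sub>2 * y\<^sub>1 ^ d'"
    proof (rule cross_inequality_poly[OF y(1,2)])
      show "i < d' \<Longrightarrow> coeff r i \<le> 0" for i using d(1)[of i] by (simp add: d'_def)
      show "d' \<le> i \<Longrightarrow> coeff r i \<ge> 0" for i
        using d(2)[of i] r(3)[of i] by (cases "d \<le> i") (auto simp: d'_def)
    qed
    moreover have "(\<Sum>l. a l * y\<^sub>1 ^ (l - k)) * y\<^sub>2 ^ d' \<le> (\<Sum>l. a l * y\<^sub>2 ^ (l - k)) * y\<^sub>1 ^ d'"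
    proof -
      have s: "summable (\<lambda>l. a l * y ^ (l - k))" if "0 < y" "y < 1" for y
        using sm[of "1 - y"] that by simp
      have "(\<Sum>l. a l * y\<^sub>1 ^ (l - k)) * y\<^sub>2 ^ d' = (\<Sum>l. a l * y\<^sub>1 ^ (l - k) * y\<^sub>2 ^ d')"
        using y by (intro suminf_mult2 s) auto
      also have "\<dots> \<le> (\<Sum>l. a l * y\<^sub>2 ^ (l - k) * y\<^sub>1 ^ d')"
      proof (rule suminf_le)
        show "a l * y\<^sub>1 ^ (l - k) * y\<^sub>2 ^ d' \<le> a l * y\<^sub>2 ^ (l - k) * y\<^sub>1 ^ d'" for l
        proof (cases "L < l")
          case True
          show ?thesis
            by (rule cross_inequality_term[OF y(1,2)]) (use True a in \<open>auto simp: d'_def\<close>)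
        qed (simp add: a_def)
      qed (use y s in \<open>auto intro!: summable_mult2\<close>)
      also have "\<dots> = (\<Sum>l. a l * y\<^sub>2 ^ (l - k)) * y\<^sub>1 ^ d'"
        using y by (intro suminf_mult2[symmetric] s) auto
      finally show ?thesis .
    qed
    ultimately show "G y\<^sub>1 * y\<^sub>2 ^ d' \<le> G y\<^sub>2 * y\<^sub>1 ^ d'"
      by (simp add: G_def distrib_right)
  qed
qed

lemma threshold_series_at_0: "threshold_series h w 0 0 = 0"
proof -
  have "binomial_tail l (h l) 0 = 0" for l
    using h_pos[of l] by (auto simp: binomial_tail_def Bernstein_def intro!: sum.neutral)
  then show ?thesis by (simp add: threshold_series_def)
qed

lemma low_mean_value:
  assumes "0 \<le> a" "a < b" "b \<le> 1"
  obtains z where "a < z" "z < b"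
    "threshold_series h low_weights 0 b - threshold_series h low_weights 0 a
       = (b - a) * threshold_series h low_weights 1 z"
proof -
  have der: "(threshold_series h low_weights 0 has_real_derivative threshold_series h low_weights 1 x) (at x within {0..1})"
    if "x \<in> {0..1}" for x
    using has_real_derivative_threshold_series[OF moments_summable_low_weights h_pos that, where i = 0] by simp
  have inner: "(threshold_series h low_weights 0 has_real_derivative threshold_series h low_weights 1 x) (at x)"
    if "a < x" "x < b" for x
    using der[of x] at_within_Icc_at[of 0 x 1] that assms by simp
  have "continuous_on {0..1} (threshold_series h low_weights 0)"
    using der by (rule DERIV_continuous_on)
  then have "continuous_on {a..b} (threshold_series h low_weights 0)"
    by (rule continuous_on_subset) (use assms in auto)
  then obtain l z where "a < z" "z < b" "(threshold_series h low_weights 0 has_real_derivative l) (at z)"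
    "threshold_series h low_weights 0 b - threshold_series h low_weights 0 a = (b - a) * l"
    using MVT[of a b "threshold_series h low_weights 0"] assms inner
    by (meson real_differentiable_def)
  then show ?thesis
    using that DERIV_unique inner by blast
qed

lemma low_positive_near_0:
  obtains \<delta> where "0 < \<delta>" "\<delta> \<le> 1" "\<And>x. 0 < x \<Longrightarrow> x < \<delta> \<Longrightarrow> threshold_series h low_weights 0 x > 0"
proof -
  obtain \<delta> where \<delta>: "0 < \<delta>" "\<delta> \<le> 1" "\<And>x. 0 < x \<Longrightarrow> x < \<delta> \<Longrightarrow> threshold_series h low_weights 1 x > 0"
    using low_deriv_eventually_positive by blast
  show ?thesis
  proof (rule that[OF \<delta>(1,2)])
    fix x assume x: "0 < x" "x < \<delta>"
    then obtain z where "0 < z" "z < x"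
      "threshold_series h low_weights 0 x - threshold_series h low_weights 0 0 = (x - 0) * threshold_series h low_weights 1 z"
      using low_mean_value[of 0 x] \<delta> by auto
    then show "threshold_series h low_weights 0 x > 0"
      using x \<delta>(3)[of z] by (simp add: threshold_series_at_0)
  qed
qed

text \<open>
  The derivative changes sign at most once, from positive to negative. So the function, which is
  positive near \<open>0\<close>, cannot drop to zero or below at \<open>p\<close> and be nonnegative again at \<open>q\<close>.
\<close>

lemma low_positive_before:
  assumes q: "q \<le> 1" "threshold_series h low_weights 0 q \<ge> 0" and p: "0 < p" "p < q"
  shows "threshold_series h low_weights 0 p > 0"
proof (rule ccontr)
  assume "\<not> ?thesis"
  then have np: "threshold_series h low_weights 0 p \<le> 0" by simp
  obtain \<delta> where \<delta>: "0 < \<delta>" "\<delta> \<le> 1" "\<And>x. 0 < x \<Longrightarrow> x < \<delta> \<Longrightarrow> threshold_series h low_weights 0 x > 0"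
    using low_positive_near_0 by blast
  define v where "v = min \<delta> p / 2"
  have v: "0 < v" "v < p" "v < \<delta>" using \<delta> p by (auto simp: v_def)
  obtain s where s: "v < s" "s < p" "threshold_series h low_weights 0 p - threshold_series h low_weights 0 v
       = (p - v) * threshold_series h low_weights 1 s"
    using low_mean_value[of v p] v p q by auto
  obtain t where t: "p < t" "t < q" "threshold_series h low_weights 0 q - threshold_series h low_weights 0 p
       = (q - p) * threshold_series h low_weights 1 t"
    using low_mean_value[of p q] p q by auto
  have "(p - v) * threshold_series h low_weights 1 s < 0"
    using s(3) np \<delta>(3)[of v] v by simp
  then have ds: "threshold_series h low_weights 1 s < 0"
    using v by (simp add: mult_less_0_iff)
  have "(q - p) * threshold_series h low_weights 1 t \<ge> 0"
    using t(3) np q by simp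
  then have dt: "threshold_series h low_weights 1 t \<ge> 0"
    using p by (simp add: zero_le_mult_iff)
  obtain k d G where G: "\<And>x. 0 < x \<Longrightarrow> x < 1 \<Longrightarrow> threshold_series h low_weights 1 x = x ^ k * G (1 - x)"
    "\<And>y\<^sub>1 y\<^sub>2. 0 < y\<^sub>1 \<Longrightarrow> y\<^sub>1 < y\<^sub>2 \<Longrightarrow> y\<^sub>2 < 1 \<Longrightarrow> G y\<^sub>1 * y\<^sub>2 ^ d \<le> G y\<^sub>2 * y\<^sub>1 ^ d"
    by (rule low_deriv_factorization) (rule that, assumption+)
  have Gs: "G (1 - s) < 0"
    using ds G(1)[of s] s t v p q by (auto simp: mult_less_0_iff zero_less_power not_less)
  have Gt: "G (1 - t) \<ge> 0"
  proof (rule ccontr)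
    assume "\<not> G (1 - t) \<ge> 0"
    moreover have "0 < t" "t < 1" using s t v p q by auto
    ultimately have "t ^ k * G (1 - t) < 0" by (intro mult_pos_neg) auto
    then show False using dt G(1)[OF \<open>0 < t\<close> \<open>t < 1\<close>] by simp
  qed
  have "G (1 - t) * (1 - s) ^ d \<le> G (1 - s) * (1 - t) ^ d"
    using s t v p q by (intro G(2)) auto
  also have "\<dots> < 0"
    using Gs t q by (intro mult_neg_pos) auto
  finally show False
    using Gt s p q by (simp add: mult_less_0_iff)
qed

end

section \<open>The branching property of the Galton--Watson measure\<close>

lemma child_iff_less_n_children:
  assumes "t \<in> rooted_trees"
  shows "v @ [i] \<in> t \<longleftrightarrow> i < n_children t v"
proof -
  define A where "A = {i. v @ [i] \<in> t}"
  have "finite A" and down: "\<And>i j. i \<in> A \<Longrightarrow> j < i \<Longrightarrow> j \<in> A"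
    using assms by (auto simp: A_def rooted_trees_def)
  define n where "n = (LEAST n. n \<notin> A)"
  have "\<exists>n. n \<notin> A" using \<open>finite A\<close> infinite_UNIV_nat by (metis UNIV_eq_I)
  then have n: "n \<notin> A" "\<And>j. j < n \<Longrightarrow> j \<in> A"
    unfolding n_def by (rule LeastI_ex) (use not_less_Least in blast)
  have "A = {..<n}"
    using n down by (auto simp: not_less) (metis linorder_neqE_nat)
  then show ?thesis
    unfolding n_children_def A_def[symmetric] by (auto simp: A_def)
qed

lemma root_child_iff: "t \<in> rooted_trees \<Longrightarrow> [i] \<in> t \<longleftrightarrow> i < n_children t []"
  using child_iff_less_n_children[of t "[]" i] by simp

lemma root_child_subtree_in_rooted_trees:
  assumes t: "t \<in> rooted_trees" and i: "[i] \<in> t"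
  shows "root_child_subtree t i \<in> rooted_trees"
proof -
  have "finite {j. (i # v) @ [j] \<in> t}" for v
    using t unfolding rooted_trees_def by blast
  moreover have "i # v \<in> t" if "i # (v @ [j]) \<in> t" for v j
    using t that unfolding rooted_trees_def by (metis (mono_tags, lifting) append_Cons mem_Collect_eq)
  moreover have "i # (v @ [k]) \<in> t" if "i # (v @ [j]) \<in> t" "k < j" for v j k
    using t that unfolding rooted_trees_def by (metis (mono_tags, lifting) append_Cons mem_Collect_eq)
  ultimately show ?thesis
    using i unfolding root_child_subtree_def rooted_trees_def by auto
qed

lemma root_child_count_eq:
  assumes "t \<in> rooted_trees"
  shows "root_child_count t T = card {i. i < n_children t [] \<and> root_child_subtree t i \<in> T}"
  using root_child_iff[OF assms] by (simp add: root_child_count_def)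

lemma n_children_tree_of: "n_children (tree_of X) [] = X []"
proof -
  have "{i. [i] \<in> tree_of X} = {..<X []}" by (auto simp: tree_of_def)
  then show ?thesis by (simp add: n_children_def)
qed

lemma root_child_subtree_tree_of:
  assumes "i < X []"
  shows "root_child_subtree (tree_of X) i = tree_of (\<lambda>v. X (i # v))"
proof -
  have "(\<forall>k<Suc (length v). (i # v) ! k < X (take k (i # v))) \<longleftrightarrow> (\<forall>k<length v. v ! k < X (i # take k v))" for v
    using assms unfolding All_less_Suc2 by simp
  then show ?thesis by (simp add: root_child_subtree_def tree_of_def)
qed

lemma space_tree_algebra [simp]: "space tree_algebra = rooted_trees"
  by (simp add: tree_algebra_def space_measure_of_conv)

lemma sets_tree_algebra:
  "sets tree_algebra = sigma_sets rooted_trees (range (\<lambda>v. {t \<in> rooted_trees. v \<in> t}))"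
  unfolding tree_algebra_def by (rule sets_measure_of) auto

lemma space_GW [simp]: "space (GW chi) = rooted_trees"
  and sets_GW [simp]: "sets (GW chi) = sets tree_algebra"
  by (simp_all add: GW_def)

lemma vertex_event: "{t \<in> rooted_trees. v \<in> t} \<in> sets tree_algebra"
  unfolding sets_tree_algebra by (rule sigma_sets.Basic) auto

lemma pred_vertex: "Measurable.pred tree_algebra (\<lambda>t. v \<in> t)"
  unfolding pred_def using vertex_event by simp

lemma n_children_root_iff:
  assumes "t \<in> rooted_trees"
  shows "n_children t [] = l \<longleftrightarrow> (\<forall>i\<in>{..<l}. [i] \<in> t) \<and> [l] \<notin> t"
  using root_child_iff[OF assms] by (auto simp: not_less le_less intro: antisym)

lemma pred_n_children: "Measurable.pred tree_algebra (\<lambda>t. n_children t [] = l)"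
proof -
  have "Measurable.pred tree_algebra (\<lambda>t. (\<forall>i\<in>{..<l}. [i] \<in> t) \<and> [l] \<notin> t)"
    by (intro pred_intros_logic pred_intros_finite pred_vertex) simp
  then show ?thesis
    by (rule measurable_cong[THEN iffD1, rotated]) (simp add: n_children_root_iff)
qed

text \<open>
  Where the child \<open>i\<close> is missing, the set of vertices below it is empty and hence no rooted tree.
  The proof puts the one-vertex tree there to obtain a measurable map on all trees.
\<close>

lemma pred_root_child_subtree:
  assumes "E \<in> sets tree_algebra"
  shows "Measurable.pred tree_algebra (\<lambda>t. [i] \<in> t \<and> root_child_subtree t i \<in> E)"
proof -
  define g where "g t = (if [i] \<in> t then root_child_subtree t i else {[]})" for t
  have trivial: "{[]} \<in> rooted_trees" by (auto simp: rooted_trees_def)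
  have g: "g \<in> tree_algebra \<rightarrow>\<^sub>M tree_algebra"
    unfolding tree_algebra_def
  proof (rule measurable_measure_of, fold tree_algebra_def)
    show "g \<in> space tree_algebra \<rightarrow> rooted_trees"
      using trivial by (auto simp: g_def root_child_subtree_in_rooted_trees)
    fix A assume "A \<in> range (\<lambda>v. {t \<in> rooted_trees. v \<in> t})"
    then obtain v where A: "A = {t \<in> rooted_trees. v \<in> t}" by blast
    have "g -` A \<inter> space tree_algebra = {t \<in> space tree_algebra. if [i] \<in> t then i # v \<in> t else v = []}"
      using trivial by (auto simp: A g_def root_child_subtree_in_rooted_trees)
        (auto simp: root_child_subtree_def)
    also have "\<dots> \<in> sets tree_algebra"
      using pred_vertex by (intro predE pred_intros_logic measurable_If) auto
    finally show "g -` A \<inter> space tree_algebra \<in> sets tree_algebra" .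
  qed auto
  have "{t \<in> space tree_algebra. g t \<in> E} = g -` E \<inter> space tree_algebra" by auto
  then have "Measurable.pred tree_algebra (\<lambda>t. g t \<in> E)"
    unfolding pred_def using measurable_sets[OF g assms] by metis
  then have "Measurable.pred tree_algebra (\<lambda>t. [i] \<in> t \<and> g t \<in> E)"
    by (intro pred_intros_logic pred_vertex)
  moreover have "[i] \<in> t \<and> g t \<in> E \<longleftrightarrow> [i] \<in> t \<and> root_child_subtree t i \<in> E" for t
    by (auto simp: g_def)
  ultimately show ?thesis by simp
qed

lemma branching_event_measurable:
  assumes "\<And>i. i < l \<Longrightarrow> E i \<in> sets tree_algebra"
  shows "{t \<in> rooted_trees. n_children t [] = l \<and> (\<forall>i<l. root_child_subtree t i \<in> E i)} \<in> sets tree_algebra"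
proof -
  have "Measurable.pred tree_algebra (\<lambda>t. n_children t [] = l \<and> (\<forall>i\<in>{..<l}. [i] \<in> t \<and> root_child_subtree t i \<in> E i))"
    using assms by (intro pred_intros_logic pred_n_children pred_intros_finite pred_root_child_subtree) auto
  then have "{t \<in> rooted_trees. n_children t [] = l \<and> (\<forall>i\<in>{..<l}. [i] \<in> t \<and> root_child_subtree t i \<in> E i)} \<in> sets tree_algebra"
    by (simp add: pred_def)
  also have "{t \<in> rooted_trees. n_children t [] = l \<and> (\<forall>i\<in>{..<l}. [i] \<in> t \<and> root_child_subtree t i \<in> E i)}
      = {t \<in> rooted_trees. n_children t [] = l \<and> (\<forall>i<l. root_child_subtree t i \<in> E i)}"
    using root_child_iff by auto
  finally show ?thesis .
qed

lemma indep_coordinates: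
  fixes M :: "'i \<Rightarrow> 'a measure"
  assumes M: "\<And>i. prob_space (M i)"
  shows "prob_space.indep_vars (PiM UNIV M) M (\<lambda>i \<omega>. \<omega> i) UNIV"
proof -
  interpret prob_space "PiM UNIV M" by (intro prob_space_PiM M)
  have "distr (PiM UNIV M) (PiM UNIV M) (\<lambda>\<omega>. \<lambda>i\<in>UNIV. \<omega> i) = PiM UNIV M"
    using distr_id by (simp add: restrict_UNIV id_def)
  moreover have "(\<Pi>\<^sub>M i\<in>UNIV. distr (PiM UNIV M) (M i) (\<lambda>\<omega>. \<omega> i)) = PiM UNIV M"
    by (intro PiM_cong distr_PiM_component M) auto
  ultimately show ?thesis
    by (subst indep_vars_iff_distr_eq_PiM') (auto intro: measurable_component_singleton)
qed

text \<open>
  The offspring number of the root and the fields of offspring numbers below the vertices \<open>[i]\<close>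
  depend on disjoint sets of coordinates, hence are independent; each of these fields is a
  relabelled copy of the whole field. The block \<open>None\<close> is the root, and the block \<open>Some i\<close> is the
  set of vertices below \<open>[i]\<close>, including those that are not present in the tree.
\<close>

lemma coordinates_branching:
  fixes chi :: "nat pmf" and l :: nat and E :: "nat \<Rightarrow> vertex set set"
  defines "\<Omega> \<equiv> \<Pi>\<^sub>M v\<in>(UNIV :: vertex set). measure_pmf chi"
  assumes E: "\<And>i. i < l \<Longrightarrow> E i \<in> sets tree_algebra"
  shows "measure \<Omega> {X. X [] = l \<and> (\<forall>i<l. tree_of (\<lambda>v. X (i # v)) \<in> E i)}
    = pmf chi l * (\<Prod>i<l. measure (GW chi) (E i))"
proof -
  interpret prob_space \<Omega> unfolding \<Omega>_def by (intro prob_space_PiM prob_space_measure_pmf)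
  have space: "space \<Omega> = UNIV" by (simp add: \<Omega>_def space_PiM)
  define K :: "nat option \<Rightarrow> vertex set" where "K j = (case j of None \<Rightarrow> {[]} | Some i \<Rightarrow> range ((#) i))" for j
  define P where "P j = (\<Pi>\<^sub>M v\<in>K j. measure_pmf chi)" for j
  have indep: "indep_vars P (\<lambda>j \<omega>. restrict \<omega> (K j)) UNIV"
    unfolding P_def
  proof (rule indep_vars_restrict)
    show "indep_vars (\<lambda>_. measure_pmf chi) (\<lambda>v \<omega>. \<omega> v) UNIV"
      unfolding \<Omega>_def by (rule indep_coordinates) (rule prob_space_measure_pmf)
    show "disjoint_family_on K UNIV"
      by (auto simp: disjoint_family_on_def K_def split: option.splits)
  qed auto
  have shift: "(\<lambda>\<omega>. \<lambda>v. \<omega> (i # v)) \<in> P (Some i) \<rightarrow>\<^sub>M \<Omega>" for i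
  proof -
    have "(\<lambda>\<omega>. \<lambda>v\<in>UNIV. \<omega> (i # v)) \<in> P (Some i) \<rightarrow>\<^sub>M \<Omega>"
      unfolding \<Omega>_def P_def by (intro measurable_restrict measurable_component_singleton) (simp add: K_def)
    then show ?thesis by (simp add: restrict_UNIV)
  qed
  have tree: "tree_of \<in> \<Omega> \<rightarrow>\<^sub>M tree_algebra"
    unfolding \<Omega>_def by (rule measurable_tree_of)
  define A where "A j = (case j of None \<Rightarrow> (\<lambda>\<omega>. \<omega> []) -` {l} \<inter> space (P j)
      | Some i \<Rightarrow> (\<lambda>\<omega>. tree_of (\<lambda>v. \<omega> (i # v))) -` E i \<inter> space (P j))" for j
  define J where "J = insert None (Some ` {..<l})"
  have A: "A j \<in> sets (P j)" if "j \<in> J" for j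
  proof (cases j)
    case None
    have "(\<lambda>\<omega>. \<omega> []) \<in> P None \<rightarrow>\<^sub>M measure_pmf chi"
      unfolding P_def by (intro measurable_component_singleton) (simp add: K_def)
    then show ?thesis
      unfolding A_def None by (auto intro: measurable_sets)
  next
    case (Some i)
    then have "i < l" using that by (auto simp: J_def)
    then show ?thesis
      unfolding A_def Some option.case
      using measurable_sets[OF measurable_compose[OF shift tree] E] by blast
  qed
  have preimage: "(\<lambda>\<omega>. restrict \<omega> (K j)) -` A j \<inter> space \<Omega> = (case j of None \<Rightarrow> {X. X [] = l}
      | Some i \<Rightarrow> {X. tree_of (\<lambda>v. X (i # v)) \<in> E i})" for j
  proof (cases j)
    case None
    have "restrict \<omega> (K None) [] = \<omega> []" for \<omega> :: "vertex \<Rightarrow> nat"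
      by (simp add: K_def)
    then show ?thesis
      unfolding None A_def option.case space P_def by (auto simp: space_PiM)
  next
    case (Some i)
    have "restrict \<omega> (K (Some i)) (i # v) = \<omega> (i # v)" for \<omega> :: "vertex \<Rightarrow> nat" and v
      by (simp add: K_def)
    then show ?thesis
      unfolding Some A_def option.case space P_def by (auto simp: space_PiM)
  qed
  have "(\<Inter>j\<in>J. case j of None \<Rightarrow> {X. X [] = l} | Some i \<Rightarrow> {X. tree_of (\<lambda>v. X (i # v)) \<in> E i})
      = {X. X [] = l \<and> (\<forall>i<l. tree_of (\<lambda>v. X (i # v)) \<in> E i)}"
    by (auto simp: J_def)
  then have "prob {X. X [] = l \<and> (\<forall>i<l. tree_of (\<lambda>v. X (i # v)) \<in> E i)}
      = prob (\<Inter>j\<in>J. (\<lambda>\<omega>. restrict \<omega> (K j)) -` A j \<inter> space \<Omega>)"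
    unfolding preimage by simp
  also have "\<dots> = (\<Prod>j\<in>J. prob ((\<lambda>\<omega>. restrict \<omega> (K j)) -` A j \<inter> space \<Omega>))"
    by (rule indep_varsD[OF indep]) (simp_all add: A, simp_all add: J_def)
  also have "\<dots> = (\<Prod>j\<in>J. prob (case j of None \<Rightarrow> {X. X [] = l} | Some i \<Rightarrow> {X. tree_of (\<lambda>v. X (i # v)) \<in> E i}))"
    unfolding preimage ..
  also have "(\<Prod>j\<in>J. prob (case j of None \<Rightarrow> {X. X [] = l} | Some i \<Rightarrow> {X. tree_of (\<lambda>v. X (i # v)) \<in> E i}))
      = prob {X. X [] = l} * (\<Prod>i<l. prob {X. tree_of (\<lambda>v. X (i # v)) \<in> E i})"
    unfolding J_def by (subst prod.insert) (auto simp: prod.reindex)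
  also have "prob {X. X [] = l} = pmf chi l"
  proof -
    have d: "distr \<Omega> (measure_pmf chi) (\<lambda>\<omega>. \<omega> []) = measure_pmf chi"
      unfolding \<Omega>_def by (intro distr_PiM_component prob_space_measure_pmf) auto
    have m: "(\<lambda>\<omega>. \<omega> []) \<in> \<Omega> \<rightarrow>\<^sub>M measure_pmf chi"
      unfolding \<Omega>_def by (intro measurable_component_singleton) simp
    have "pmf chi l = measure (distr \<Omega> (measure_pmf chi) (\<lambda>\<omega>. \<omega> [])) {l}"
      unfolding d by (simp add: measure_pmf_single)
    also have "\<dots> = prob {X. X [] = l}"
      using m by (subst measure_distr) (auto simp: space vimage_def)
    finally show ?thesis by simp
  qed
  also have "(\<Prod>i<l. prob {X. tree_of (\<lambda>v. X (i # v)) \<in> E i}) = (\<Prod>i<l. measure (GW chi) (E i))"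
  proof (rule prod.cong[OF refl])
    fix i assume "i \<in> {..<l}"
    then have Ei: "E i \<in> sets tree_algebra" using E by simp
    have d: "distr \<Omega> \<Omega> (\<lambda>\<omega>. \<lambda>v. \<omega> (i # v)) = \<Omega>"
      using distr_PiM_reindex[of UNIV "\<lambda>_. measure_pmf chi" "(#) i" UNIV]
      by (simp add: \<Omega>_def prob_space_measure_pmf restrict_UNIV)
    have m: "(\<lambda>\<omega>. \<lambda>v. \<omega> (i # v)) \<in> \<Omega> \<rightarrow>\<^sub>M \<Omega>"
    proof -
      have "(\<lambda>\<omega>. \<lambda>v\<in>UNIV. \<omega> (i # v)) \<in> \<Omega> \<rightarrow>\<^sub>M \<Omega>"
        unfolding \<Omega>_def by (intro measurable_restrict measurable_component_singleton) simp
      then show ?thesis by (simp add: restrict_UNIV)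
    qed
    have "measure (GW chi) (E i) = measure \<Omega> (tree_of -` E i \<inter> space \<Omega>)"
      unfolding GW_def \<Omega>_def[symmetric] by (intro measure_distr tree Ei)
    also have "\<dots> = measure (distr \<Omega> \<Omega> (\<lambda>\<omega>. \<lambda>v. \<omega> (i # v))) (tree_of -` E i \<inter> space \<Omega>)"
      unfolding d ..
    also have "\<dots> = prob {X. tree_of (\<lambda>v. X (i # v)) \<in> E i}"
      using measurable_sets[OF tree Ei] by (subst measure_distr[OF m]) (auto simp: space vimage_def)
    finally show "prob {X. tree_of (\<lambda>v. X (i # v)) \<in> E i} = measure (GW chi) (E i)" by simp
  qed
  finally show ?thesis .
qed

lemma GW_branching:
  assumes E: "\<And>i. i < l \<Longrightarrow> E i \<in> sets tree_algebra"
  shows "measure (GW chi) {t \<in> rooted_trees. n_children t [] = l \<and> (\<forall>i<l. root_child_subtree t i \<in> E i)}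
    = pmf chi l * (\<Prod>i<l. measure (GW chi) (E i))"
proof -
  let ?A = "{t \<in> rooted_trees. n_children t [] = l \<and> (\<forall>i<l. root_child_subtree t i \<in> E i)}"
  let ?\<Omega> = "\<Pi>\<^sub>M v\<in>(UNIV :: vertex set). measure_pmf chi"
  have "measure (GW chi) ?A = measure ?\<Omega> (tree_of -` ?A \<inter> space ?\<Omega>)"
    unfolding GW_def by (intro measure_distr measurable_tree_of branching_event_measurable E)
  also have "tree_of -` ?A \<inter> space ?\<Omega> = {X. X [] = l \<and> (\<forall>i<l. tree_of (\<lambda>v. X (i # v)) \<in> E i)}"
    by (auto simp: tree_of_in_rooted_trees n_children_tree_of root_child_subtree_tree_of space_PiM)
  finally show ?thesis
    using coordinates_branching[OF E] by simp
qed

text \<open>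
  The index \<open>J\<close> of the union is the exact set of root children whose subtrees lie in \<open>T\<close>, which
  makes the union disjoint and each member a branching event.
\<close>

lemma branching_count_event_eq:
  "{t \<in> rooted_trees. n_children t [] = l \<and> (\<forall>i<l. root_child_subtree t i \<in> F i) \<and> k \<le> root_child_count t T}
   = (\<Union>J\<in>{J. J \<subseteq> {..<l} \<and> k \<le> card J}. {t \<in> rooted_trees. n_children t [] = l \<and>
       (\<forall>i<l. root_child_subtree t i \<in> (if i \<in> J then F i \<inter> T else F i - T))})"
proof (intro set_eqI iffI)
  fix t assume t: "t \<in> {t \<in> rooted_trees. n_children t [] = l \<and> (\<forall>i<l. root_child_subtree t i \<in> F i) \<and> k \<le> root_child_count t T}"
  show "t \<in> (\<Union>J\<in>{J. J \<subseteq> {..<l} \<and> k \<le> card J}. {t \<in> rooted_trees. n_children t [] = l \<and>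
       (\<forall>i<l. root_child_subtree t i \<in> (if i \<in> J then F i \<inter> T else F i - T))})"
  proof (intro UN_I[of "{i. i < l \<and> root_child_subtree t i \<in> T}"])
    show "{i. i < l \<and> root_child_subtree t i \<in> T} \<in> {J. J \<subseteq> {..<l} \<and> k \<le> card J}"
      using t by (auto simp: root_child_count_eq)
    show "t \<in> {t' \<in> rooted_trees. n_children t' [] = l \<and> (\<forall>i<l. root_child_subtree t' i
        \<in> (if i \<in> {i. i < l \<and> root_child_subtree t i \<in> T} then F i \<inter> T else F i - T))}"
      using t by simp
  qed
next
  fix t assume "t \<in> (\<Union>J\<in>{J. J \<subseteq> {..<l} \<and> k \<le> card J}. {t \<in> rooted_trees. n_children t [] = l \<and>
       (\<forall>i<l. root_child_subtree t i \<in> (if i \<in> J then F i \<inter> T else F i - T))})"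
  then obtain J where J: "J \<subseteq> {..<l}" "k \<le> card J" and t: "t \<in> rooted_trees" "n_children t [] = l"
    and sub: "\<And>i. i < l \<Longrightarrow> root_child_subtree t i \<in> (if i \<in> J then F i \<inter> T else F i - T)"
    by auto
  have "root_child_subtree t i \<in> T \<longleftrightarrow> i \<in> J" if "i < l" for i
    using sub[OF that] by (auto split: if_splits)
  then have "{i. i < l \<and> root_child_subtree t i \<in> T} = J"
    using J by auto
  moreover have "root_child_subtree t i \<in> F i" if "i < l" for i
    using sub[OF that] by (auto split: if_splits)
  ultimately show "t \<in> {t \<in> rooted_trees. n_children t [] = l \<and> (\<forall>i<l. root_child_subtree t i \<in> F i) \<and> k \<le> root_child_count t T}"
    using t J by (simp add: root_child_count_eq)
qed

lemma branching_count_event_measurable: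
  assumes "T \<in> sets tree_algebra" "\<And>i. i < l \<Longrightarrow> F i \<in> sets tree_algebra"
  shows "{t \<in> rooted_trees. n_children t [] = l \<and> (\<forall>i<l. root_child_subtree t i \<in> F i) \<and> k \<le> root_child_count t T}
    \<in> sets tree_algebra"
  unfolding branching_count_event_eq
proof (rule sets.finite_UN)
  fix J
  show "{t \<in> rooted_trees. n_children t [] = l \<and>
      (\<forall>i<l. root_child_subtree t i \<in> (if i \<in> J then F i \<inter> T else F i - T))} \<in> sets tree_algebra"
    by (rule branching_event_measurable) (use assms in auto)
qed simp

lemma GW_branching_count:
  assumes T: "T \<in> sets tree_algebra" and F: "\<And>i. i < l \<Longrightarrow> F i \<in> sets tree_algebra"
  shows "measure (GW chi)
      {t \<in> rooted_trees. n_children t [] = l \<and> (\<forall>i<l. root_child_subtree t i \<in> F i) \<and> k \<le> root_child_count t T}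
    = pmf chi l * (\<Sum>J | J \<subseteq> {..<l} \<and> k \<le> card J.
        (\<Prod>i\<in>J. measure (GW chi) (F i \<inter> T)) * (\<Prod>i\<in>{..<l} - J. measure (GW chi) (F i - T)))"
proof -
  interpret prob_space "GW chi" by (rule prob_space_GW)
  define B where "B J = {t \<in> rooted_trees. n_children t [] = l \<and>
       (\<forall>i<l. root_child_subtree t i \<in> (if i \<in> J then F i \<inter> T else F i - T))}" for J
  define S where "S = {J. J \<subseteq> {..<l} \<and> k \<le> card J}"
  have E: "(if i \<in> J then F i \<inter> T else F i - T) \<in> sets tree_algebra" if "i < l" for i J
    using T F[OF that] by auto
  have "finite S" unfolding S_def by simp
  moreover have "B ` S \<subseteq> events"
    unfolding B_def sets_GW by (intro image_subsetI branching_event_measurable E)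
  moreover have "disjoint_family_on B S"
    unfolding disjoint_family_on_def
  proof (intro ballI impI)
    fix J J' assume J: "J \<in> S" "J' \<in> S" "J \<noteq> J'"
    then obtain i where i: "i < l" "(i \<in> J) \<noteq> (i \<in> J')" unfolding S_def by blast
    show "B J \<inter> B J' = {}"
    proof (rule ccontr)
      assume "B J \<inter> B J' \<noteq> {}"
      then obtain t where "t \<in> B J" "t \<in> B J'" by blast
      then have "root_child_subtree t i \<in> (if i \<in> J then F i \<inter> T else F i - T)"
        "root_child_subtree t i \<in> (if i \<in> J' then F i \<inter> T else F i - T)"
        using i(1) unfolding B_def by blast+
      then show False using i(2) by (auto split: if_splits)
    qed
  qed
  ultimately have "prob (\<Union>J\<in>S. B J) = (\<Sum>J\<in>S. prob (B J))"
    by (rule finite_measure_finite_Union)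
  also have "\<dots> = (\<Sum>J\<in>S. pmf chi l * ((\<Prod>i\<in>J. prob (F i \<inter> T)) * (\<Prod>i\<in>{..<l} - J. prob (F i - T))))"
  proof (rule sum.cong[OF refl])
    fix J assume "J \<in> S"
    then have J: "{..<l} \<inter> J = J" "{..<l} \<inter> - J = {..<l} - J"
      unfolding S_def by auto
    have "prob (B J) = pmf chi l * (\<Prod>i<l. prob (if i \<in> J then F i \<inter> T else F i - T))"
      unfolding B_def by (rule GW_branching[OF E])
    also have "(\<Prod>i<l. prob (if i \<in> J then F i \<inter> T else F i - T))
        = (\<Prod>i<l. if i \<in> J then prob (F i \<inter> T) else prob (F i - T))"
      by (intro prod.cong) auto
    also have "\<dots> = (\<Prod>i\<in>J. prob (F i \<inter> T)) * (\<Prod>i\<in>{..<l} - J. prob (F i - T))"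
      by (simp add: prod.If_cases J)
    finally show "prob (B J) = pmf chi l * ((\<Prod>i\<in>J. prob (F i \<inter> T)) * (\<Prod>i\<in>{..<l} - J. prob (F i - T)))" .
  qed
  finally show ?thesis
    unfolding branching_count_event_eq B_def S_def by (simp add: sum_distrib_left)
qed

lemma sum_subsets_eq_binomial_tail:
  "(\<Sum>J | J \<subseteq> {..<l} \<and> k \<le> card J. (\<Prod>i\<in>J. p) * (\<Prod>i\<in>{..<l} - J. 1 - p)) = binomial_tail l k p"
proof -
  let ?S = "{J. J \<subseteq> {..<l} \<and> k \<le> card J}"
  have "(\<Sum>J\<in>?S. (\<Prod>i\<in>J. p) * (\<Prod>i\<in>{..<l} - J. 1 - p)) = (\<Sum>J\<in>?S. p ^ card J * (1 - p) ^ (l - card J))"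
    by (intro sum.cong) (auto simp: card_Diff_subset finite_subset)
  also have "\<dots> = (\<Sum>j=k..l. \<Sum>J\<in>{J \<in> ?S. card J = j}. p ^ card J * (1 - p) ^ (l - card J))"
    by (rule sum.group[symmetric]) (auto dest: card_mono[rotated])
  also have "\<dots> = (\<Sum>j=k..l. Bernstein l j p)"
  proof (rule sum.cong[OF refl])
    fix j assume "j \<in> {k..l}"
    then have "{J \<in> ?S. card J = j} = {J. J \<subseteq> {..<l} \<and> card J = j}" by auto
    then have "card {J \<in> ?S. card J = j} = l choose j"
      using n_subsets[of "{..<l}" j] by simp
    moreover have "(\<Sum>J\<in>{J \<in> ?S. card J = j}. p ^ card J * (1 - p) ^ (l - card J))
       = (\<Sum>J\<in>{J \<in> ?S. card J = j}. p ^ j * (1 - p) ^ (l - j))"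
      by (rule sum.cong) auto
    ultimately show "(\<Sum>J\<in>{J \<in> ?S. card J = j}. p ^ card J * (1 - p) ^ (l - card J)) = Bernstein l j p"
      by (simp add: Bernstein_def)
  qed
  finally show ?thesis by (simp add: binomial_tail_def)
qed

text \<open>
  A tree with \<open>n\<close> root children can be accepted only if \<open>n \<in> I\<close>. An interpretation is a fixed point
  for \<open>I = UNIV\<close> up to a null set.
\<close>

definition threshold_step :: "(nat \<Rightarrow> nat) \<Rightarrow> nat set \<Rightarrow> vertex set set \<Rightarrow> vertex set set" where
  "threshold_step h I T = {t \<in> rooted_trees. n_children t [] \<in> I \<and> h (n_children t []) \<le> root_child_count t T}"

lemma
  assumes T: "T \<in> sets tree_algebra"
  shows threshold_step_measurable: "threshold_step h I T \<in> sets tree_algebra"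
    and measure_threshold_step: "measure (GW chi) (threshold_step h I T)
      = threshold_series h (\<lambda>l. if l \<in> I then pmf chi l else 0) 0 (measure (GW chi) T)"
proof -
  interpret prob_space "GW chi" by (rule prob_space_GW)
  define D where "D l = {t \<in> rooted_trees. l \<in> I \<and> n_children t [] = l \<and> h l \<le> root_child_count t T}" for l
  have space_minus: "prob (rooted_trees - T) = 1 - prob T"
    using prob_compl[of T] T by simp
  have TR: "rooted_trees \<inter> T = T" using sets.sets_into_space[OF T] by auto
  have sub: "root_child_subtree t i \<in> rooted_trees" if "t \<in> rooted_trees" "i < n_children t []" for t i
    using that root_child_subtree_in_rooted_trees root_child_iff by blast
  have D_eq: "D l = (if l \<in> I then {t \<in> rooted_trees. n_children t [] = l \<and>
      (\<forall>i<l. root_child_subtree t i \<in> rooted_trees) \<and> h l \<le> root_child_count t T} else {})" for l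
    using sub by (auto simp: D_def)
  have RT: "rooted_trees \<in> sets tree_algebra"
    using sets.top[of tree_algebra] by simp
  have step: "threshold_step h I T = (\<Union>l. D l)"
    by (auto simp: threshold_step_def D_def)
  have D: "D l \<in> sets tree_algebra" for l
  proof (cases "l \<in> I")
    case True
    show ?thesis
      unfolding D_eq if_P[OF True] by (rule branching_count_event_measurable[OF T RT])
  next
    case False
    show ?thesis unfolding D_eq if_not_P[OF False] by (rule sets.empty_sets)
  qed
  have prob_D: "prob (D l) = (if l \<in> I then pmf chi l else 0) * binomial_tail_deriv 0 l (h l) (prob T)" for l
  proof (cases "l \<in> I")
    case True
    show ?thesis
      unfolding D_eq if_P[OF True] GW_branching_count[OF T RT] TR space_minus sum_subsets_eq_binomial_tail
      by simp
  next
    case False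
    show ?thesis unfolding D_eq if_not_P[OF False] by simp
  qed
  show "threshold_step h I T \<in> sets tree_algebra"
    unfolding step by (intro sets.countable_UN image_subsetI D)
  have "(\<lambda>l. prob (D l)) sums prob (\<Union>l. D l)"
  proof (rule finite_measure_UNION)
    show "range D \<subseteq> events" unfolding sets_GW by (intro image_subsetI D)
    show "disjoint_family D" by (auto simp: disjoint_family_on_def D_def)
  qed
  then show "prob (threshold_step h I T) = threshold_series h (\<lambda>l. if l \<in> I then pmf chi l else 0) 0 (prob T)"
    unfolding step threshold_series_def prob_D by (rule sums_unique)
qed

section \<open>The event as an iterated threshold step\<close>

lemma n_children_root_child_subtree: "n_children (root_child_subtree s i) v = n_children s (i # v)"
  by (simp add: n_children_def root_child_subtree_def)

lemma finite_root_children: "t \<in> rooted_trees \<Longrightarrow> finite {i. [i] \<in> t}"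
  by (simp add: root_child_iff)

lemma root_child_count_mono:
  assumes "t \<in> rooted_trees" "\<And>i. [i] \<in> t \<Longrightarrow> root_child_subtree t i \<in> T \<Longrightarrow> root_child_subtree t i \<in> T'"
  shows "root_child_count t T \<le> root_child_count t T'"
  unfolding root_child_count_def
  by (rule card_mono) (use assms finite_root_children[OF assms(1)] in auto)

lemma threshold_step_mono:
  assumes "I \<subseteq> I'" "T \<subseteq> T'"
  shows "threshold_step h I T \<subseteq> threshold_step h I' T'"
proof
  fix t assume t: "t \<in> threshold_step h I T"
  then have "root_child_count t T \<le> root_child_count t T'"
    using assms(2) by (intro root_child_count_mono) (auto simp: threshold_step_def)
  then show "t \<in> threshold_step h I' T'"
    using t assms(1) by (auto simp: threshold_step_def)
qed

lemma threshold_step_subset: "threshold_step h I T \<subseteq> rooted_trees"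
  by (auto simp: threshold_step_def)

text \<open>
  The step commutes with monotone limits because only finitely many subtrees are inspected.
\<close>

lemma threshold_step_Inter:
  assumes "decseq B"
  shows "threshold_step h I (\<Inter>n. B n) = (\<Inter>n. threshold_step h I (B n))"
proof
  show "threshold_step h I (\<Inter>n. B n) \<subseteq> (\<Inter>n. threshold_step h I (B n))"
    by (rule INT_greatest, rule threshold_step_mono[OF subset_refl], rule INT_lower, rule UNIV_I)
  show "(\<Inter>n. threshold_step h I (B n)) \<subseteq> threshold_step h I (\<Inter>n. B n)"
  proof
    fix t assume t: "t \<in> (\<Inter>n. threshold_step h I (B n))"
    then have rt: "t \<in> rooted_trees" by (auto simp: threshold_step_def)
    have "\<exists>n. \<forall>i<l. root_child_subtree t i \<in> B n \<longrightarrow> (\<forall>k. root_child_subtree t i \<in> B k)" for l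
    proof (induction l)
      case (Suc l)
      then obtain n where n: "\<And>i k. i < l \<Longrightarrow> root_child_subtree t i \<in> B n \<Longrightarrow> root_child_subtree t i \<in> B k"
        by blast
      obtain n' where n': "\<And>k. root_child_subtree t l \<in> B n' \<Longrightarrow> root_child_subtree t l \<in> B k"
        by blast
      have "B (max n n') \<subseteq> B n" "B (max n n') \<subseteq> B n'"
        using assms by (auto simp: decseq_def)
      then show ?case
        using n n' by (intro exI[of _ "max n n'"]) (auto simp: less_Suc_eq)
    qed simp
    then obtain n where "\<And>i k. i < n_children t [] \<Longrightarrow> root_child_subtree t i \<in> B n \<Longrightarrow> root_child_subtree t i \<in> B k"
      by blast
    then have "root_child_count t (B n) \<le> root_child_count t (\<Inter>n. B n)"
      using rt by (intro root_child_count_mono) (auto simp: root_child_iff)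
    then show "t \<in> threshold_step h I (\<Inter>n. B n)"
      using t by (auto simp: threshold_step_def intro: order_trans)
  qed
qed

lemma threshold_step_Union:
  assumes "incseq B"
  shows "threshold_step h I (\<Union>n. B n) = (\<Union>n. threshold_step h I (B n))"
proof
  show "(\<Union>n. threshold_step h I (B n)) \<subseteq> threshold_step h I (\<Union>n. B n)"
    by (rule UN_least, rule threshold_step_mono[OF subset_refl], rule UN_upper, rule UNIV_I)
  show "threshold_step h I (\<Union>n. B n) \<subseteq> (\<Union>n. threshold_step h I (B n))"
  proof
    fix t assume t: "t \<in> threshold_step h I (\<Union>n. B n)"
    then have rt: "t \<in> rooted_trees" by (auto simp: threshold_step_def)
    have "\<exists>n. \<forall>i<l. root_child_subtree t i \<in> (\<Union>k. B k) \<longrightarrow> root_child_subtree t i \<in> B n" for l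
    proof (induction l)
      case (Suc l)
      then obtain n where n: "\<And>i. i < l \<Longrightarrow> root_child_subtree t i \<in> (\<Union>k. B k) \<Longrightarrow> root_child_subtree t i \<in> B n"
        by blast
      obtain n' where n': "root_child_subtree t l \<in> (\<Union>k. B k) \<Longrightarrow> root_child_subtree t l \<in> B n'"
        by blast
      have B: "B n \<subseteq> B (max n n')" "B n' \<subseteq> B (max n n')"
        using assms by (auto simp: incseq_def)
      show ?case
      proof (intro exI[of _ "max n n'"] allI impI)
        fix i assume "i < Suc l" "root_child_subtree t i \<in> (\<Union>k. B k)"
        then show "root_child_subtree t i \<in> B (max n n')"
          using n[of i] n' B by (cases "i = l") (blast, simp add: less_Suc_eq, blast)
      qed
    qed simp
    then obtain n where "\<And>i. i < n_children t [] \<Longrightarrow> root_child_subtree t i \<in> (\<Union>k. B k) \<Longrightarrow> root_child_subtree t i \<in> B n"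
      by blast
    then have "root_child_count t (\<Union>n. B n) \<le> root_child_count t (B n)"
      using rt by (intro root_child_count_mono) (auto simp: root_child_iff)
    then show "t \<in> (\<Union>n. threshold_step h I (B n))"
      using t by (auto simp: threshold_step_def intro: order_trans)
  qed
qed

text \<open>
  Starting from all trees, the step restricted to thresholds at most \<open>m\<close> decreases to the event
  that some admissible subtree has at most \<open>m\<close> children at every vertex. Starting from the latter,
  the unrestricted step increases to the event with finitely many exceptional vertices;
  \<open>bounded_from h m n\<close> allows them on the first \<open>n\<close> levels.
\<close>

definition bounded_up_to :: "(nat \<Rightarrow> nat) \<Rightarrow> nat \<Rightarrow> nat \<Rightarrow> vertex set set" where
  "bounded_up_to h m n = (threshold_step h {l. h l \<le> m} ^^ n) rooted_trees"

definition bounded_event :: "(nat \<Rightarrow> nat) \<Rightarrow> nat \<Rightarrow> vertex set set" where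
  "bounded_event h m = (\<Inter>n. bounded_up_to h m n)"

definition bounded_from :: "(nat \<Rightarrow> nat) \<Rightarrow> nat \<Rightarrow> nat \<Rightarrow> vertex set set" where
  "bounded_from h m n = (threshold_step h UNIV ^^ n) (bounded_event h m)"

lemma bounded_up_to_0 [simp]: "bounded_up_to h m 0 = rooted_trees"
  and bounded_up_to_Suc: "bounded_up_to h m (Suc n) = threshold_step h {l. h l \<le> m} (bounded_up_to h m n)"
  by (simp_all add: bounded_up_to_def)

lemma bounded_from_0 [simp]: "bounded_from h m 0 = bounded_event h m"
  and bounded_from_Suc: "bounded_from h m (Suc n) = threshold_step h UNIV (bounded_from h m n)"
  by (simp_all add: bounded_from_def)

lemma decseq_bounded_up_to: "decseq (bounded_up_to h m)"
proof (rule decseq_SucI)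
  show "bounded_up_to h m (Suc n) \<subseteq> bounded_up_to h m n" for n
  proof (induction n)
    case (Suc n)
    show ?case
      using threshold_step_mono[OF subset_refl Suc.IH] unfolding bounded_up_to_Suc .
  qed (simp add: bounded_up_to_Suc threshold_step_subset)
qed

lemma bounded_event_fixed: "threshold_step h {l. h l \<le> m} (bounded_event h m) = bounded_event h m"
proof -
  have "(\<Inter>n. bounded_up_to h m n) = (\<Inter>n. bounded_up_to h m (Suc n))"
  proof
    show "(\<Inter>n. bounded_up_to h m (Suc n)) \<subseteq> (\<Inter>n. bounded_up_to h m n)"
      using decseq_SucD[OF decseq_bounded_up_to] by blast
  qed blast
  then show ?thesis
    unfolding bounded_event_def threshold_step_Inter[OF decseq_bounded_up_to] bounded_up_to_Suc by simp
qed

lemma incseq_bounded_from: "incseq (bounded_from h m)"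
proof (rule incseq_SucI)
  show "bounded_from h m n \<subseteq> bounded_from h m (Suc n)" for n
  proof (induction n)
    case 0
    have "bounded_event h m = threshold_step h {l. h l \<le> m} (bounded_event h m)"
      by (simp add: bounded_event_fixed)
    also have "\<dots> \<subseteq> threshold_step h UNIV (bounded_event h m)"
      by (rule threshold_step_mono) auto
    finally show ?case by (simp add: bounded_from_Suc)
  next
    case (Suc n)
    show ?case
      using threshold_step_mono[OF subset_refl Suc.IH] unfolding bounded_from_Suc .
  qed
qed

lemma bounded_from_fixed: "threshold_step h UNIV (\<Union>n. bounded_from h m n) = (\<Union>n. bounded_from h m n)"
proof -
  have "(\<Union>n. bounded_from h m n) = (\<Union>n. bounded_from h m (Suc n))"
    using incseq_SucD[OF incseq_bounded_from[of h m]] by blast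
  then show ?thesis
    unfolding threshold_step_Union[OF incseq_bounded_from] bounded_from_Suc by simp
qed

lemma admissible_subtree_root_child:
  assumes "admissible_subtree h t s" "[i] \<in> s"
  shows "admissible_subtree h (root_child_subtree t i) (root_child_subtree s i)"
  unfolding admissible_subtree_def
proof (intro conjI allI impI ballI)
  show "root_child_subtree s i \<subseteq> root_child_subtree t i"
    using assms by (auto simp: admissible_subtree_def root_child_subtree_def)
  show "[] \<in> root_child_subtree s i"
    using assms by (simp add: root_child_subtree_def)
  show "v \<in> root_child_subtree s i" if "v @ [j] \<in> root_child_subtree s i" for v j
  proof -
    have "(i # v) @ [j] \<in> s" using that by (simp add: root_child_subtree_def)
    then have "i # v \<in> s" using assms(1) unfolding admissible_subtree_def by blast
    then show ?thesis by (simp add: root_child_subtree_def)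
  qed
  show "h (n_children (root_child_subtree t i) v) \<le> n_children (root_child_subtree s i) v"
    if "v \<in> root_child_subtree s i" for v
    using assms(1) that unfolding n_children_root_child_subtree
    by (simp add: admissible_subtree_def root_child_subtree_def)
qed

lemma admissible_subtree_root_child_count:
  assumes t: "t \<in> rooted_trees" and s: "admissible_subtree h t s"
    and T: "\<And>i. [i] \<in> s \<Longrightarrow> root_child_subtree t i \<in> T"
  shows "h (n_children t []) \<le> root_child_count t T"
proof -
  have "h (n_children t []) \<le> n_children s []"
    using s by (simp add: admissible_subtree_def)
  also have "\<dots> = card {i. [i] \<in> s}"
    by (simp add: n_children_def)
  also have "\<dots> \<le> root_child_count t T"
    unfolding root_child_count_def
    by (rule card_mono) (use s T finite_root_children[OF t] in \<open>auto simp: admissible_subtree_def\<close>)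
  finally show ?thesis .
qed

lemma bounded_subtree_in_bounded_event:
  assumes "t \<in> rooted_trees" "admissible_subtree h t s" "\<And>v. v \<in> s \<Longrightarrow> n_children s v \<le> m"
  shows "t \<in> bounded_event h m"
proof -
  have "t \<in> bounded_up_to h m n" for n
    using assms
  proof (induction n arbitrary: t s)
    case (Suc n)
    have root: "[] \<in> s" "h (n_children t []) \<le> n_children s []"
      using Suc.prems(2) by (auto simp: admissible_subtree_def)
    have "root_child_subtree t i \<in> bounded_up_to h m n" if "[i] \<in> s" for i
    proof (rule Suc.IH)
      show "root_child_subtree t i \<in> rooted_trees"
        using Suc.prems that by (intro root_child_subtree_in_rooted_trees) (auto simp: admissible_subtree_def)
      show "admissible_subtree h (root_child_subtree t i) (root_child_subtree s i)"
        by (rule admissible_subtree_root_child[OF Suc.prems(2) that])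
      show "n_children (root_child_subtree s i) v \<le> m" if "v \<in> root_child_subtree s i" for v
        using Suc.prems(3)[of "i # v"] that by (simp add: root_child_subtree_def n_children_root_child_subtree[unfolded root_child_subtree_def])
    qed
    then have "h (n_children t []) \<le> root_child_count t (bounded_up_to h m n)"
      by (rule admissible_subtree_root_child_count[OF Suc.prems(1,2)])
    then show ?case
      using Suc.prems(1,3) root unfolding bounded_up_to_Suc threshold_step_def by force
  qed simp
  then show ?thesis by (simp add: bounded_event_def)
qed

text \<open>
  Each step of the induction strips one level, and after \<open>n\<close> levels no exceptional vertex is left.
\<close>

lemma bounded_below_level_in_bounded_from:
  assumes "t \<in> rooted_trees" "admissible_subtree h t s"
    "\<And>v. v \<in> s \<Longrightarrow> length v \<ge> n \<Longrightarrow> n_children s v \<le> m"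
  shows "t \<in> bounded_from h m n"
  using assms
proof (induction n arbitrary: t s)
  case 0
  then show ?case using bounded_subtree_in_bounded_event[of t h s m] by simp
next
  case (Suc n)
  have "root_child_subtree t i \<in> bounded_from h m n" if "[i] \<in> s" for i
  proof (rule Suc.IH)
    show "root_child_subtree t i \<in> rooted_trees"
      using Suc.prems that by (intro root_child_subtree_in_rooted_trees) (auto simp: admissible_subtree_def)
    show "admissible_subtree h (root_child_subtree t i) (root_child_subtree s i)"
      by (rule admissible_subtree_root_child[OF Suc.prems(2) that])
    show "n_children (root_child_subtree s i) v \<le> m" if "v \<in> root_child_subtree s i" "n \<le> length v" for v
      using Suc.prems(3)[of "i # v"] that by (simp add: root_child_subtree_def n_children_root_child_subtree[unfolded root_child_subtree_def])
  qed
  then have "h (n_children t []) \<le> root_child_count t (bounded_from h m n)"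
    by (rule admissible_subtree_root_child_count[OF Suc.prems(1,2)])
  then show ?case
    using Suc.prems(1) by (simp add: bounded_from_Suc threshold_step_def)
qed

text \<open>
  A subtree is grown level by level: below each vertex whose subtree lies in the event, exactly as
  many children as the threshold requires are kept among those whose subtrees lie in the event
  again. The threshold is at most \<open>m\<close> for every tree in the event.
\<close>

lemma bounded_event_has_bounded_subtree:
  assumes "t \<in> bounded_event h m"
  obtains s where "admissible_subtree h t s" "\<And>v. v \<in> s \<Longrightarrow> n_children s v \<le> m"
proof -
  let ?U = "bounded_event h m"
  have step: "u \<in> rooted_trees \<and> h (n_children u []) \<le> m \<and> h (n_children u []) \<le> root_child_count u ?U" if "u \<in> ?U" for u
    using that bounded_event_fixed[of h m] by (auto simp: threshold_step_def)
  have "\<forall>u\<in>?U. \<exists>C. C \<subseteq> {i. [i] \<in> u \<and> root_child_subtree u i \<in> ?U} \<and> card C = h (n_children u [])"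
  proof
    fix u assume "u \<in> ?U"
    then have "h (n_children u []) \<le> card {i. [i] \<in> u \<and> root_child_subtree u i \<in> ?U}"
      using step[of u] by (simp add: root_child_count_def)
    then obtain C where "C \<subseteq> {i. [i] \<in> u \<and> root_child_subtree u i \<in> ?U}" "card C = h (n_children u [])"
      by (rule obtain_subset_with_card_n)
    then show "\<exists>C. C \<subseteq> {i. [i] \<in> u \<and> root_child_subtree u i \<in> ?U} \<and> card C = h (n_children u [])"
      by blast
  qed
  from bchoice[OF this] obtain C where C:
    "\<And>u. u \<in> ?U \<Longrightarrow> C u \<subseteq> {i. [i] \<in> u \<and> root_child_subtree u i \<in> ?U}"
    "\<And>u. u \<in> ?U \<Longrightarrow> card (C u) = h (n_children u [])"
    by blast
  define D where "D v = {w. v @ w \<in> t}" for v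
  define s where "s = {v. \<forall>k<length v. v ! k \<in> C (D (take k v))}"
  have s_Nil: "[] \<in> s" by (simp add: s_def)
  have s_snoc: "v @ [i] \<in> s \<longleftrightarrow> v \<in> s \<and> i \<in> C (D v)" for v i
    by (auto simp: s_def less_Suc_eq nth_append)
  have D_snoc: "D (v @ [i]) = root_child_subtree (D v) i" for v i
    by (simp add: D_def root_child_subtree_def)
  have DU: "D v \<in> ?U" if "v \<in> s" for v
    using that
  proof (induction v rule: rev_induct)
    case Nil
    then show ?case using assms by (simp add: D_def)
  next
    case (snoc i v)
    then have "v \<in> s" "i \<in> C (D v)" using s_snoc by auto
    then show ?case using C(1) snoc.IH unfolding D_snoc by blast
  qed
  have children: "n_children s v = h (n_children t v)" if "v \<in> s" for v
  proof -
    have "{i. v @ [i] \<in> s} = C (D v)" using that s_snoc by auto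
    then have "n_children s v = h (n_children (D v) [])"
      unfolding n_children_def[of s] using C(2)[OF DU[OF that]] by simp
    also have "n_children (D v) [] = n_children t v"
      by (simp add: n_children_def D_def)
    finally show ?thesis .
  qed
  show ?thesis
  proof (rule that)
    show "admissible_subtree h t s"
      unfolding admissible_subtree_def
    proof (intro conjI allI impI ballI)
      show "s \<subseteq> t"
      proof
        fix v assume "v \<in> s"
        then have "[] \<in> D v" using step[OF DU] by (auto simp: rooted_trees_def)
        then show "v \<in> t" by (simp add: D_def)
      qed
    qed (use s_Nil s_snoc children in auto)
    show "n_children s v \<le> m" if "v \<in> s" for v
    proof -
      have "n_children (D v) [] = n_children t v"
        by (simp add: n_children_def D_def)
      then show ?thesis using children[OF that] step[OF DU[OF that]] by simp
    qed
  qed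
qed

text \<open>
  Admissible subtrees below the accepting root children are joined at the root. All of these
  children are used, and only the root is a possible new exceptional vertex.
\<close>

lemma threshold_step_eventually_bounded:
  "threshold_step h UNIV (eventually_bounded_admissible_event h m) \<subseteq> eventually_bounded_admissible_event h m"
proof
  let ?E = "eventually_bounded_admissible_event h m"
  fix t assume "t \<in> threshold_step h UNIV ?E"
  then have t: "t \<in> rooted_trees" "h (n_children t []) \<le> root_child_count t ?E"
    by (auto simp: threshold_step_def)
  define C where "C = {i. [i] \<in> t \<and> root_child_subtree t i \<in> ?E}"
  have "finite C" unfolding C_def using finite_root_children[OF t(1)] by simp
  have "\<exists>s. admissible_subtree h (root_child_subtree t i) s \<and> finite {v \<in> s. \<not> n_children s v \<le> m}" if "i \<in> C" for i
    using that by (auto simp: C_def eventually_bounded_admissible_event_def)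
  then obtain S where S: "\<And>i. i \<in> C \<Longrightarrow> admissible_subtree h (root_child_subtree t i) (S i)"
    "\<And>i. i \<in> C \<Longrightarrow> finite {v \<in> S i. \<not> n_children (S i) v \<le> m}"
    by metis
  define s where "s = insert [] {i # v |i v. i \<in> C \<and> v \<in> S i}"
  have s_Nil: "[] \<in> s" by (simp add: s_def)
  have s_Cons: "i # v \<in> s \<longleftrightarrow> i \<in> C \<and> v \<in> S i" for i v
    by (simp add: s_def)
  have root: "[] \<in> S i" if "i \<in> C" for i
    using S(1)[OF that] by (simp add: admissible_subtree_def)
  have children: "n_children s (i # v) = n_children (S i) v" if "i \<in> C" for i v
    using that by (simp add: n_children_def s_Cons)
  have root_children: "n_children s [] = card C"
  proof -
    have "{i \<in> C. [] \<in> S i} = C" using root by blast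
    then show ?thesis by (simp add: n_children_def s_Cons)
  qed
  have "admissible_subtree h t s"
    unfolding admissible_subtree_def
  proof (intro conjI allI impI ballI)
    show "s \<subseteq> t"
    proof
      fix v assume v: "v \<in> s"
      show "v \<in> t"
      proof (cases v)
        case Nil
        then show ?thesis using t(1) by (simp add: rooted_trees_def)
      next
        case (Cons i w)
        then have "i \<in> C" "w \<in> S i" using v s_Cons by auto
        then show ?thesis using S(1)[OF \<open>i \<in> C\<close>] Cons by (auto simp: admissible_subtree_def root_child_subtree_def)
      qed
    qed
    show "v \<in> s" if "v @ [j] \<in> s" for v j
    proof (cases v)
      case (Cons i w)
      then have "i \<in> C" "w @ [j] \<in> S i" using that s_Cons by auto
      then have "w \<in> S i" using S(1) unfolding admissible_subtree_def by blast
      then show ?thesis using Cons \<open>i \<in> C\<close> s_Cons by simp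
    qed (simp add: s_Nil)
    show "h (n_children t v) \<le> n_children s v" if "v \<in> s" for v
    proof (cases v)
      case Nil
      then show ?thesis using t(2) root_children by (simp add: root_child_count_def C_def)
    next
      case (Cons i w)
      then have "i \<in> C" "w \<in> S i" using that s_Cons by auto
      then show ?thesis
        using S(1)[OF \<open>i \<in> C\<close>] Cons children
        by (simp add: admissible_subtree_def n_children_root_child_subtree)
    qed
  qed (rule s_Nil)
  moreover have "finite {v \<in> s. \<not> n_children s v \<le> m}"
  proof (rule finite_subset)
    show "{v \<in> s. \<not> n_children s v \<le> m} \<subseteq> insert [] (\<Union>i\<in>C. (#) i ` {v \<in> S i. \<not> n_children (S i) v \<le> m})"
    proof
      fix v assume v: "v \<in> {v \<in> s. \<not> n_children s v \<le> m}"
      show "v \<in> insert [] (\<Union>i\<in>C. (#) i ` {v \<in> S i. \<not> n_children (S i) v \<le> m})"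
      proof (cases v)
        case (Cons i w)
        then have "i \<in> C" "w \<in> S i" using v s_Cons by auto
        then show ?thesis using v Cons children by auto
      qed simp
    qed
    show "finite (insert [] (\<Union>i\<in>C. (#) i ` {v \<in> S i. \<not> n_children (S i) v \<le> m}))"
      using \<open>finite C\<close> S(2) by auto
  qed
  ultimately show "t \<in> ?E"
    using t(1) by (auto simp: eventually_bounded_admissible_event_def)
qed

lemma eventually_bounded_admissible_event_eq:
  "eventually_bounded_admissible_event h m = (\<Union>n. bounded_from h m n)"
proof
  show "eventually_bounded_admissible_event h m \<subseteq> (\<Union>n. bounded_from h m n)"
  proof
    fix t assume "t \<in> eventually_bounded_admissible_event h m"
    then obtain s where t: "t \<in> rooted_trees" and s: "admissible_subtree h t s"
      and fin: "finite {v \<in> s. \<not> n_children s v \<le> m}"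
      by (auto simp: eventually_bounded_admissible_event_def)
    obtain n where n: "\<And>v. v \<in> {v \<in> s. \<not> n_children s v \<le> m} \<Longrightarrow> length v < n"
      using finite_nat_set_iff_bounded[of "length ` {v \<in> s. \<not> n_children s v \<le> m}"] fin by auto
    have "t \<in> bounded_from h m n"
      by (rule bounded_below_level_in_bounded_from[OF t s]) (use n in fastforce)
    then show "t \<in> (\<Union>n. bounded_from h m n)" by blast
  qed
  have "bounded_from h m n \<subseteq> eventually_bounded_admissible_event h m" for n
  proof (induction n)
    case 0
    show ?case
    proof
      fix t assume t: "t \<in> bounded_from h m 0"
      then obtain s where s: "admissible_subtree h t s" "\<And>v. v \<in> s \<Longrightarrow> n_children s v \<le> m"
        using bounded_event_has_bounded_subtree[of t h m] by auto
      then have "{v \<in> s. \<not> n_children s v \<le> m} = {}" by auto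
      moreover have "t \<in> rooted_trees"
      proof -
        have "t \<in> bounded_up_to h m 0"
          using t unfolding bounded_from_0 bounded_event_def by blast
        then show ?thesis by simp
      qed
      ultimately show "t \<in> eventually_bounded_admissible_event h m"
        using s(1) unfolding eventually_bounded_admissible_event_def by (metis (mono_tags, lifting) finite.emptyI mem_Collect_eq)
    qed
  next
    case (Suc n)
    have "bounded_from h m (Suc n) \<subseteq> threshold_step h UNIV (eventually_bounded_admissible_event h m)"
      unfolding bounded_from_Suc by (rule threshold_step_mono[OF subset_refl Suc.IH])
    then show ?case using threshold_step_eventually_bounded by blast
  qed
  then show "(\<Union>n. bounded_from h m n) \<subseteq> eventually_bounded_admissible_event h m" by blast
qed

section \<open>Uniqueness of the interpretation of a fixed point\<close>

definition trees_containing :: "vertex set \<Rightarrow> vertex set set" where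
  "trees_containing V = {t \<in> rooted_trees. V \<subseteq> t}"

lemma trees_containing_measurable:
  assumes "finite V"
  shows "trees_containing V \<in> sets tree_algebra"
proof -
  have "trees_containing V = {t \<in> space tree_algebra. \<forall>v\<in>V. v \<in> t}"
    by (auto simp: trees_containing_def)
  also have "\<dots> \<in> sets tree_algebra"
    using assms vertex_event by (intro sets.sets_Collect_finite_All) auto
  finally show ?thesis .
qed

lemma trees_containing_Int: "trees_containing V \<inter> trees_containing W = trees_containing (V \<union> W)"
  by (auto simp: trees_containing_def)

lemma sets_tree_algebra_containing:
  "sets tree_algebra = sigma_sets rooted_trees (trees_containing ` {V. finite V})"
proof
  show "sets tree_algebra \<subseteq> sigma_sets rooted_trees (trees_containing ` {V. finite V})"
    unfolding sets_tree_algebra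
  proof (rule sigma_sets_mono, rule image_subsetI)
    fix v :: vertex
    have "{t \<in> rooted_trees. v \<in> t} = trees_containing {v}"
      by (auto simp: trees_containing_def)
    then show "{t \<in> rooted_trees. v \<in> t} \<in> sigma_sets rooted_trees (trees_containing ` {V. finite V})"
      by (auto intro: sigma_sets.Basic)
  qed
  show "sigma_sets rooted_trees (trees_containing ` {V. finite V}) \<subseteq> sets tree_algebra"
    using sets.sigma_sets_subset[of "trees_containing ` {V. finite V}" tree_algebra]
      trees_containing_measurable by auto
qed

lemma trees_containing_iff_root_children:
  assumes t: "t \<in> rooted_trees" and l: "n_children t [] = l"
  shows "V \<subseteq> t \<longleftrightarrow> (\<forall>i w. i # w \<in> V \<longrightarrow> i < l) \<and> (\<forall>i<l. {w. i # w \<in> V} \<subseteq> root_child_subtree t i)"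
proof
  have prefix: "[i] \<in> t" if "i # w \<in> t" for i w
    using that
  proof (induction w rule: rev_induct)
    case (snoc j w)
    then have "(i # w) @ [j] \<in> t" by simp
    then have "i # w \<in> t" using t unfolding rooted_trees_def by blast
    then show ?case by (rule snoc.IH)
  qed
  assume "V \<subseteq> t"
  then show "(\<forall>i w. i # w \<in> V \<longrightarrow> i < l) \<and> (\<forall>i<l. {w. i # w \<in> V} \<subseteq> root_child_subtree t i)"
    using prefix root_child_iff[OF t] l by (auto simp: root_child_subtree_def)
next
  assume V: "(\<forall>i w. i # w \<in> V \<longrightarrow> i < l) \<and> (\<forall>i<l. {w. i # w \<in> V} \<subseteq> root_child_subtree t i)"
  show "V \<subseteq> t"
  proof
    fix v assume "v \<in> V"
    then show "v \<in> t"
      using V t by (cases v) (auto simp: root_child_subtree_def rooted_trees_def)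
  qed
qed

text \<open>
  Interpretations in the uncompleted \<open>\<sigma>\<close>-algebra, to which the branching property applies
  directly.
\<close>

definition interpretation_event :: "nat pmf \<Rightarrow> (nat \<Rightarrow> nat) \<Rightarrow> vertex set set \<Rightarrow> bool" where
  "interpretation_event chi h T \<longleftrightarrow> T \<in> sets tree_algebra
     \<and> (AE t in GW chi. t \<in> T \<longleftrightarrow> root_child_count t T \<ge> h (n_children t []))"

text \<open>
  Decomposition by the number \<open>l\<close> of root children and by the set \<open>J\<close> of those children whose
  subtrees lie in \<open>T\<close>. The right-hand side involves \<open>T\<close> only through events of one level less.
\<close>

lemma interpretation_event_containing_sums:
  assumes T: "interpretation_event chi h T" and V: "finite V"
  shows "(\<lambda>l. if \<forall>i w. i # w \<in> V \<longrightarrow> i < l then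
      pmf chi l * (\<Sum>J | J \<subseteq> {..<l} \<and> h l \<le> card J.
        (\<Prod>i\<in>J. measure (GW chi) (trees_containing {w. i # w \<in> V} \<inter> T)) *
        (\<Prod>i\<in>{..<l} - J. measure (GW chi) (trees_containing {w. i # w \<in> V} - T))) else 0)
    sums measure (GW chi) (T \<inter> trees_containing V)"
proof -
  interpret prob_space "GW chi" by (rule prob_space_GW)
  have Tm: "T \<in> sets tree_algebra" using T by (simp add: interpretation_event_def)
  have fin: "finite {w. i # w \<in> V}" for i
    using finite_vimageI[OF V, of "(#) i"] by (simp add: vimage_def)
  define F where "F i = trees_containing {w. i # w \<in> V}" for i
  have F: "F i \<in> sets tree_algebra" for i
    unfolding F_def by (rule trees_containing_measurable[OF fin])
  define D where "D l = (if \<forall>i w. i # w \<in> V \<longrightarrow> i < l then {t \<in> rooted_trees. n_children t [] = l \<and>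
      (\<forall>i<l. root_child_subtree t i \<in> F i) \<and> h l \<le> root_child_count t T} else {})" for l
  have D: "D l \<in> sets tree_algebra" for l
  proof (cases "\<forall>i w. i # w \<in> V \<longrightarrow> i < l")
    case True
    show ?thesis
      unfolding D_def if_P[OF True] by (rule branching_count_event_measurable[OF Tm F])
  next
    case False
    show ?thesis unfolding D_def if_not_P[OF False] by (rule sets.empty_sets)
  qed
  have sub: "root_child_subtree t i \<in> rooted_trees" if "t \<in> rooted_trees" "i < n_children t []" for t i
    using that root_child_subtree_in_rooted_trees root_child_iff by blast
  have D_iff: "t \<in> D l \<longleftrightarrow> t \<in> rooted_trees \<and> n_children t [] = l \<and> V \<subseteq> t \<and> h l \<le> root_child_count t T" for t l
    using trees_containing_iff_root_children[of t l V] sub[of t]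
    unfolding D_def F_def trees_containing_def by auto
  have "(\<lambda>l. prob (D l)) sums prob (\<Union>l. D l)"
  proof (rule finite_measure_UNION)
    show "range D \<subseteq> events" unfolding sets_GW by (intro image_subsetI D)
    show "disjoint_family D" by (auto simp: disjoint_family_on_def D_iff)
  qed
  also have "prob (\<Union>l. D l) = prob (T \<inter> trees_containing V)"
  proof (rule finite_measure_eq_AE)
    have "AE t in GW chi. t \<in> rooted_trees"
      using AE_space[of "GW chi"] by simp
    moreover have "AE t in GW chi. t \<in> T \<longleftrightarrow> root_child_count t T \<ge> h (n_children t [])"
      using T by (simp add: interpretation_event_def)
    ultimately show "AE t in GW chi. t \<in> (\<Union>l. D l) \<longleftrightarrow> t \<in> T \<inter> trees_containing V"
      by eventually_elim (auto simp: D_iff trees_containing_def)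
    show "(\<Union>l. D l) \<in> events" unfolding sets_GW by (intro sets.countable_UN image_subsetI D)
    show "T \<inter> trees_containing V \<in> events"
      unfolding sets_GW by (intro sets.Int Tm trees_containing_measurable V)
  qed
  also have "(\<lambda>l. prob (D l)) = (\<lambda>l. if \<forall>i w. i # w \<in> V \<longrightarrow> i < l then
      pmf chi l * (\<Sum>J | J \<subseteq> {..<l} \<and> h l \<le> card J.
        (\<Prod>i\<in>J. prob (F i \<inter> T)) * (\<Prod>i\<in>{..<l} - J. prob (F i - T))) else 0)"
  proof
    fix l
    show "prob (D l) = (if \<forall>i w. i # w \<in> V \<longrightarrow> i < l then
      pmf chi l * (\<Sum>J | J \<subseteq> {..<l} \<and> h l \<le> card J.
        (\<Prod>i\<in>J. prob (F i \<inter> T)) * (\<Prod>i\<in>{..<l} - J. prob (F i - T))) else 0)"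
    proof (cases "\<forall>i w. i # w \<in> V \<longrightarrow> i < l")
      case True
      show ?thesis
        unfolding D_def if_P[OF True] by (rule GW_branching_count[OF Tm F])
    next
      case False
      show ?thesis
        unfolding D_def if_not_P[OF False] by simp
    qed
  qed
  finally show ?thesis unfolding F_def .
qed

text \<open>
  Given the levels up to \<open>n\<close>, the subtrees rooted at level \<open>n\<close> lie in \<open>T\<close> independently, each with
  probability \<open>measure (GW chi) T\<close>, and almost surely these memberships determine that of the whole
  tree. So the joint law of membership and of finitely many levels depends on \<open>T\<close> only through that
  probability. The induction removes one level at a time.
\<close>

lemma interpretation_event_containing_eq:
  assumes T: "interpretation_event chi h T" and U: "interpretation_event chi h U"
    and eq: "measure (GW chi) T = measure (GW chi) U"
    and V: "finite V" "\<And>v. v \<in> V \<Longrightarrow> length v < n"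
  shows "measure (GW chi) (T \<inter> trees_containing V) = measure (GW chi) (U \<inter> trees_containing V)"
  using V
proof (induction n arbitrary: V)
  case 0
  then have "V = {}" by auto
  moreover have "T \<inter> rooted_trees = T" "U \<inter> rooted_trees = U"
    using T U sets.sets_into_space[of _ tree_algebra] by (auto simp: interpretation_event_def)
  ultimately show ?case using eq by (simp add: trees_containing_def)
next
  case (Suc n)
  interpret prob_space "GW chi" by (rule prob_space_GW)
  have Tm: "T \<in> sets tree_algebra" "U \<in> sets tree_algebra"
    using T U by (simp_all add: interpretation_event_def)
  have IH: "prob (trees_containing {w. i # w \<in> V} \<inter> T) = prob (trees_containing {w. i # w \<in> V} \<inter> U)"
    "prob (trees_containing {w. i # w \<in> V} - T) = prob (trees_containing {w. i # w \<in> V} - U)" for i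
  proof -
    have fin: "finite {w. i # w \<in> V}"
      using finite_vimageI[OF Suc.prems(1), of "(#) i"] by (simp add: vimage_def)
    then show eq: "prob (trees_containing {w. i # w \<in> V} \<inter> T) = prob (trees_containing {w. i # w \<in> V} \<inter> U)"
      using Suc.IH[of "{w. i # w \<in> V}"] Suc.prems(2) by (force simp: Int_commute)
    have m: "trees_containing {w. i # w \<in> V} \<in> events"
      using trees_containing_measurable[OF fin] by simp
    show "prob (trees_containing {w. i # w \<in> V} - T) = prob (trees_containing {w. i # w \<in> V} - U)"
      using finite_measure_Diff'[of _ T] finite_measure_Diff'[of _ U] m Tm eq by simp
  qed
  show ?case
    by (rule sums_unique2[OF interpretation_event_containing_sums[OF T Suc.prems(1), unfolded IH]
          interpretation_event_containing_sums[OF U Suc.prems(1)]])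
qed

text \<open>
  Two interpretations of equal measure have the same intersection measure with every set of a
  generating \<open>\<pi>\<close>-system, hence with every event; the events \<open>T - U\<close> and \<open>U - T\<close> are then null.
\<close>

lemma interpretation_event_unique:
  assumes T: "interpretation_event chi h T" and U: "interpretation_event chi h U"
    and eq: "measure (GW chi) T = measure (GW chi) U"
  shows "AE t in GW chi. t \<in> T \<longleftrightarrow> t \<in> U"
proof -
  interpret prob_space "GW chi" by (rule prob_space_GW)
  have Tm: "T \<in> events" "U \<in> events"
    using T U by (simp_all add: interpretation_event_def)
  have emeasure: "emeasure (density (GW chi) (indicator S)) A = emeasure (GW chi) (S \<inter> A)"
    if "S \<in> events" "A \<in> events" for S A
    using that by (subst emeasure_density) (auto simp: indicator_inter_arith[symmetric] intro!: borel_measurable_indicator)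
  have "density (GW chi) (indicator T) = density (GW chi) (indicator U)"
  proof (rule measure_eqI_generator_eq[where \<Omega> = rooted_trees and E = "trees_containing ` {V. finite V}"
        and A = "\<lambda>_. trees_containing {}"])
    show "Int_stable (trees_containing ` {V. finite V})"
      by (auto simp: Int_stable_def trees_containing_Int)
    show "trees_containing ` {V. finite V} \<subseteq> Pow rooted_trees"
      by (auto simp: trees_containing_def)
    show "emeasure (density (GW chi) (indicator T)) A = emeasure (density (GW chi) (indicator U)) A"
      if "A \<in> trees_containing ` {V. finite V}" for A
    proof -
      obtain V where V: "finite V" "A = trees_containing V" using \<open>A \<in> _\<close> by auto
      obtain n where "\<And>v. v \<in> V \<Longrightarrow> length v < n"
        using finite_nat_set_iff_bounded[of "length ` V"] V(1) by auto
      then have "prob (T \<inter> A) = prob (U \<inter> A)"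
        unfolding V(2) by (rule interpretation_event_containing_eq[OF T U eq V(1)])
      moreover have "A \<in> events"
        using trees_containing_measurable V by simp
      ultimately show ?thesis
        using Tm by (simp add: emeasure emeasure_eq_measure)
    qed
    show "range (\<lambda>_. trees_containing {}) \<subseteq> trees_containing ` {V. finite V}"
      by auto
    show "(\<Union>i::nat. trees_containing {}) = rooted_trees"
      by (simp add: trees_containing_def)
    show "emeasure (density (GW chi) (indicator T)) (trees_containing {}) \<noteq> \<infinity>"
      using Tm trees_containing_measurable[of "{}"] by (simp add: emeasure emeasure_eq_measure)
  qed (simp_all add: sets_tree_algebra_containing)
  then have all: "emeasure (GW chi) (T \<inter> A) = emeasure (GW chi) (U \<inter> A)" if "A \<in> events" for A
    using emeasure[OF Tm(1) that] emeasure[OF Tm(2) that] by simp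
  have "T \<inter> (T - U) = T - U" "U \<inter> (T - U) = {}" "U \<inter> (U - T) = U - T" "T \<inter> (U - T) = {}" by auto
  then have "T - U \<in> null_sets (GW chi)" "U - T \<in> null_sets (GW chi)"
    using all[of "T - U"] all[of "U - T"] Tm by (auto simp: null_sets_def)
  then have "AE t in GW chi. t \<notin> T - U" "AE t in GW chi. t \<notin> U - T"
    by (auto dest: AE_not_in)
  then show ?thesis by eventually_elim auto
qed

text \<open>
  This allows an interpretation to be modified on a null set: almost surely the number of accepting
  root children stays the same.
\<close>

lemma AE_root_child_subtree_notin:
  assumes N: "N \<in> null_sets (GW chi)"
  shows "AE t in GW chi. \<forall>i<n_children t []. root_child_subtree t i \<notin> N"
proof -
  interpret prob_space "GW chi" by (rule prob_space_GW)
  have RT: "rooted_trees \<in> sets tree_algebra" using sets.top[of tree_algebra] by simp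
  have Nm: "N \<in> sets tree_algebra" "prob N = 0"
    using N by (auto simp: null_sets_def measure_def)
  have sub: "root_child_subtree t i \<in> rooted_trees" if "t \<in> rooted_trees" "i < n_children t []" for t i
    using that root_child_subtree_in_rooted_trees root_child_iff by blast
  have single: "AE t in GW chi. \<not> (n_children t [] = l \<and> root_child_subtree t i \<in> N)" if il: "i < l" for l i
  proof -
    define E where "E j = (if j = i then N else rooted_trees)" for j
    have E: "E j \<in> sets tree_algebra" for j using Nm RT by (simp add: E_def)
    define B where "B = {t \<in> rooted_trees. n_children t [] = l \<and> (\<forall>j<l. root_child_subtree t j \<in> E j)}"
    have "(\<Prod>j<l. prob (E j)) = 0"
      using il Nm(2) by (intro prod_zero) (auto simp: E_def intro!: bexI[of _ i])
    then have "prob B = 0"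
      unfolding B_def GW_branching[OF E] by simp
    moreover have "B \<in> events"
      unfolding B_def sets_GW by (rule branching_event_measurable[OF E])
    ultimately have "B \<in> null_sets (GW chi)"
      by (auto simp: null_sets_def emeasure_eq_measure)
    from AE_not_in[OF this] AE_space[of "GW chi"] show ?thesis
    proof eventually_elim
      case (elim t)
      then show ?case
        using il sub[of t] by (auto simp: B_def E_def split: if_splits)
    qed
  qed
  have "AE t in GW chi. \<forall>i\<in>{..<l}. \<not> (n_children t [] = l \<and> root_child_subtree t i \<in> N)" for l
    by (rule AE_finite_allI) (simp, rule single, simp)
  then have "AE t in GW chi. \<forall>l. \<forall>i\<in>{..<l}. \<not> (n_children t [] = l \<and> root_child_subtree t i \<in> N)"
    by (subst AE_all_countable) blast
  then show ?thesis by eventually_elim auto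
qed

lemma interpretation_of_imp_event:
  assumes "interpretation_of chi h T"
  obtains S where "interpretation_event chi h S" "AE t in GW chi. t \<in> T \<longleftrightarrow> t \<in> S"
    "measure (GW chi) S = measure (completion (GW chi)) T"
proof -
  have T: "T \<in> sets (completion (GW chi))"
    and interp: "AE t in GW chi. t \<in> T \<longleftrightarrow> root_child_count t T \<ge> h (n_children t [])"
    using assms by (simp_all add: interpretation_of_def)
  obtain S N N' where S: "T = S \<union> N" "N \<subseteq> N'" "N' \<in> null_sets (GW chi)" "S \<in> sets (GW chi)"
    using T by (rule sets_completionE)
  have TS: "AE t in GW chi. t \<in> T \<longleftrightarrow> t \<in> S"
    using AE_not_in[OF S(3)] by eventually_elim (use S in auto)
  have "AE t in GW chi. t \<in> S \<longleftrightarrow> root_child_count t S \<ge> h (n_children t [])"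
    using interp TS AE_root_child_subtree_notin[OF S(3)] AE_space[of "GW chi"]
  proof eventually_elim
    case (elim t)
    then have "root_child_count t T = root_child_count t S"
      using S by (simp add: root_child_count_eq) (intro arg_cong[where f = card], auto)
    then show ?case using elim by simp
  qed
  then have "interpretation_event chi h S"
    using S(4) by (simp add: interpretation_event_def)
  moreover have "measure (GW chi) S = measure (completion (GW chi)) T"
  proof -
    interpret C: prob_space "completion (GW chi)"
      by (intro prob_space.prob_space_completion prob_space_GW)
    have "measure (completion (GW chi)) T = measure (completion (GW chi)) S"
      using AE_completion[OF TS] T S(4) by (intro C.finite_measure_eq_AE) auto
    then show ?thesis using S(4) by simp
  qed
  ultimately show ?thesis using that TS by blast
qed

section \<open>The smallest nonzero fixed point\<close>

lemma binomial_tail_mono: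
  assumes "k \<ge> 1" "0 \<le> x" "x \<le> y" "y \<le> 1"
  shows "binomial_tail l k x \<le> binomial_tail l k y"
proof (rule DERIV_nonneg_imp_nondecreasing[OF assms(3)])
  fix z assume "x \<le> z" "z \<le> y"
  then have "0 \<le> real l * Bernstein (l - 1) (k - 1) z"
    using assms by (intro mult_nonneg_nonneg Bernstein_nonneg) auto
  then show "\<exists>d. (binomial_tail l k has_real_derivative d) (at z) \<and> 0 \<le> d"
    using has_real_derivative_binomial_tail[OF assms(1)] by blast
qed

lemma threshold_series_mono:
  assumes v: "moments_summable v" and w: "moments_summable w" and h: "\<And>l. h l \<ge> 1"
    and vw: "\<And>l. 0 \<le> v l" "\<And>l. v l \<le> w l" and x: "0 \<le> x" "x \<le> y" "y \<le> 1"
  shows "threshold_series h v 0 x \<le> threshold_series h w 0 y"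
  unfolding threshold_series_def
proof (rule suminf_le)
  show "v l * binomial_tail_deriv 0 l (h l) x \<le> w l * binomial_tail_deriv 0 l (h l) y" for l
    using binomial_tail_mono[OF h x, of l l] binomial_tail_bounds[of x l "h l"] vw[of l] x order_trans[OF vw]
    by (auto intro!: mult_mono)
  show "summable (\<lambda>l. v l * binomial_tail_deriv 0 l (h l) x)"
    by (rule summable_threshold_series[OF v]) (use x in auto)
  show "summable (\<lambda>l. w l * binomial_tail_deriv 0 l (h l) y)"
    by (rule summable_threshold_series[OF w]) (use x in auto)
qed

lemma automaton_map_eq_threshold_series:
  assumes "x \<in> {0..1}"
  shows "automaton_map chi h x = threshold_series h (pmf chi) 0 x"
  using assms by (simp add: automaton_map_def threshold_series_def prob_binomial_eq_binomial_tail)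

definition unit_weight :: "nat \<Rightarrow> real" where
  "unit_weight l = (if l = 1 then 1 else 0)"

lemma moments_summable_unit_weight: "moments_summable unit_weight"
  by (rule moments_summable_finite_support) (simp add: unit_weight_def)

lemma threshold_series_unit_weight:
  assumes "h 1 = 1"
  shows "threshold_series h unit_weight i x = binomial_tail_deriv i 1 1 x"
proof -
  have "threshold_series h unit_weight i x = (\<Sum>l\<le>1. unit_weight l * binomial_tail_deriv i l (h l) x)"
    by (rule threshold_series_finite) (simp add: unit_weight_def)
  also have "\<dots> = binomial_tail_deriv i 1 1 x"
    using assms by (simp add: unit_weight_def)
  finally show ?thesis .
qed

lemma pmf_less_1:
  assumes "a \<in> set_pmf p" "b \<in> set_pmf p" "a \<noteq> b"
  shows "pmf p c < 1"
proof -
  obtain d where d: "d \<in> set_pmf p" "d \<noteq> c" using assms by metis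
  have "pmf p c + pmf p d = measure_pmf.prob p {c, d}"
    using d by (subst measure_measure_pmf_finite) auto
  also have "\<dots> \<le> 1" by simp
  finally show ?thesis using d pmf_positive[of d p] by linarith
qed

text \<open>
  Supercordance makes the derivative at \<open>0\<close> at least \<open>1\<close>, which forces \<open>h 1 = 1\<close>: otherwise
  \<open>h l\<close> would be at least \<open>2\<close> for all \<open>l \<ge> 1\<close>, and the derivative would vanish.
  Subtracting the identity from the automaton map then changes only the weight at \<open>1\<close>, which
  becomes negative as \<open>chi\<close> is not a point mass.
\<close>

lemma supercordant_weights:
  fixes chi :: "nat pmf" and h :: "nat \<Rightarrow> nat" and m :: nat
  assumes mom: "all_moments_finite chi"
    and support: "\<exists>a\<in>set_pmf chi. \<exists>b\<in>set_pmf chi. a \<noteq> b"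
    and h: "\<And>l. h l \<ge> 1" "mono h" and m: "m \<ge> 1" and sup: "supercordant m chi h"
  shows "concordant_weights h (\<lambda>l. pmf chi l - unit_weight l) m"
proof -
  have w: "moments_summable (pmf chi)" by (rule moments_summable_pmf[OF mom])
  have deriv: "unit_interval_deriv k (automaton_map chi h) 0 = threshold_series h (pmf chi) k 0" for k
    by (rule unit_interval_deriv_threshold_series[OF w h(1)]) (auto simp: automaton_map_eq_threshold_series)
  have d1: "threshold_series h (pmf chi) 1 0 \<ge> 1"
    using sup unfolding supercordant_def concordant_def deriv by auto
  have h1: "h 1 = 1"
  proof (rule ccontr)
    assume "h 1 \<noteq> 1"
    then have "2 \<le> h 1" using h(1)[of 1] by simp
    have "binomial_tail_deriv 1 l (h l) 0 = 0" for l
    proof (cases "l = 0")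
      case False
      then have "2 \<le> h l" using \<open>2 \<le> h 1\<close> monoD[OF h(2), of 1 l] by simp
      then have "h l - Suc 0 \<noteq> 0" by simp
      then show ?thesis by (simp add: Bernstein_def)
    qed simp
    then have "threshold_series h (pmf chi) 1 0 = 0"
      by (simp add: threshold_series_def del: One_nat_def)
    then show False using d1 by simp
  qed
  have u: "threshold_series h (\<lambda>l. pmf chi l - unit_weight l) k 0
      = unit_interval_deriv k (automaton_map chi h) 0 - binomial_tail_deriv k 1 1 0" for k
    using threshold_series_diff[OF w moments_summable_unit_weight, of 0 h k]
    by (simp only: deriv threshold_series_unit_weight[where h = h, OF h1])
  have one: "binomial_tail_deriv 1 1 1 0 = 1" by (simp add: Bernstein_def)
  have zero: "binomial_tail_deriv k 1 1 0 = 0" if "2 \<le> k" for k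
  proof -
    obtain j where "k = 2 + j" using \<open>2 \<le> k\<close> le_Suc_ex by blast
    then show ?thesis by simp
  qed
  show ?thesis
  proof
    show "pmf chi 1 - unit_weight 1 < 0"
      using support pmf_less_1[of _ chi _ 1] by (auto simp: unit_weight_def)
    show "0 \<le> pmf chi l - unit_weight l" if "l \<noteq> 1" for l
      using that by (simp add: unit_weight_def)
    show "moments_summable (\<lambda>l. pmf chi l - unit_weight l)"
      by (rule moments_summable_diff[OF w moments_summable_unit_weight])
    show "threshold_series h (\<lambda>l. pmf chi l - unit_weight l) i 0 = 0" if i: "1 \<le> i" "i < m" for i
    proof (cases "i = 1")
      case True
      then show ?thesis
        using sup i unfolding u by (auto simp: supercordant_def concordant_def one simp del: binomial_tail_deriv.simps One_nat_def)
    next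
      case False
      then show ?thesis
        using sup i zero[of i] unfolding u by (auto simp: supercordant_def concordant_def simp del: binomial_tail_deriv.simps One_nat_def)
    qed
    show "0 < threshold_series h (\<lambda>l. pmf chi l - unit_weight l) m 0"
    proof (cases "m = 1")
      case True
      then show ?thesis
        using sup unfolding u by (auto simp: supercordant_def one simp del: binomial_tail_deriv.simps One_nat_def)
    next
      case False
      then show ?thesis
        using sup m zero[of m] unfolding u by (auto simp: supercordant_def simp del: binomial_tail_deriv.simps One_nat_def)
    qed
  qed (use h m h1 in auto)
qed

lemma bounded_up_to_measurable: "bounded_up_to h m n \<in> sets tree_algebra"
proof (induction n)
  case 0
  show ?case using sets.top[of tree_algebra] by simp
next
  case (Suc n)
  show ?case unfolding bounded_up_to_Suc by (rule threshold_step_measurable[OF Suc])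
qed

lemma bounded_event_measurable: "bounded_event h m \<in> sets tree_algebra"
  unfolding bounded_event_def
  by (intro sets.countable_INT image_subsetI bounded_up_to_measurable) simp

lemma bounded_from_measurable: "bounded_from h m n \<in> sets tree_algebra"
proof (induction n)
  case 0
  show ?case by (simp add: bounded_event_measurable)
next
  case (Suc n)
  show ?case unfolding bounded_from_Suc by (rule threshold_step_measurable[OF Suc])
qed

theorem theorem1p8:
  fixes chi :: "nat pmf" and h :: "nat \<Rightarrow> nat" and m :: nat and x\<^sub>0 :: real
  assumes "all_moments_finite chi"
    and "\<exists>a\<in>set_pmf chi. \<exists>b\<in>set_pmf chi. a \<noteq> b"
    and "\<And>l. h l \<ge> 1"
    and "mono h"
    and "m \<ge> 1"
    and "supercordant m chi h"
    and "0 < x\<^sub>0" and "x\<^sub>0 \<le> 1" and "automaton_map chi h x\<^sub>0 = x\<^sub>0"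
    and "\<And>y. 0 < y \<Longrightarrow> y \<le> 1 \<Longrightarrow> automaton_map chi h y = y \<Longrightarrow> x\<^sub>0 \<le> y"
  shows "interpretable chi h x\<^sub>0
    \<and> associated_interpretation chi h x\<^sub>0 (eventually_bounded_admissible_event h m)
    \<and> (\<forall>\<T>. associated_interpretation chi h x\<^sub>0 \<T> \<longrightarrow>
         (AE t in GW chi. t \<in> \<T> \<longleftrightarrow> t \<in> eventually_bounded_admissible_event h m))"
proof -
  interpret prob_space "GW chi" by (rule prob_space_GW)
  interpret concordant_weights h "\<lambda>l. pmf chi l - unit_weight l" m
    using assms(1-6) by (rule supercordant_weights)
  let ?E = "eventually_bounded_admissible_event h m"
  define w where "w = (\<lambda>l. if l \<in> {l. h l \<le> m} then pmf chi l else 0)"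
  define \<Psi> where "\<Psi> = threshold_series h (pmf chi) 0"
  define \<Psi>\<^sub>m where "\<Psi>\<^sub>m = threshold_series h w 0"
  have moments: "moments_summable (pmf chi)" by (rule moments_summable_pmf[OF assms(1)])
  have w_moments: "moments_summable w"
    by (rule moments_summable_bounded[OF moments]) (simp add: w_def)
  have low_eq: "threshold_series h low_weights 0 x = \<Psi>\<^sub>m x - x" if "0 \<le> x" "x \<le> 1" for x
  proof -
    have "low_weights = (\<lambda>l. w l - unit_weight l)"
      unfolding low_weights_def[abs_def] w_def using h_1 m_pos by (auto simp: unit_weight_def)
    then show ?thesis
      using threshold_series_diff[OF w_moments moments_summable_unit_weight that, of h 0]
        threshold_series_unit_weight[of h 0 x, OF h_1] binomial_tail_one_one[of x]
      by (simp add: \<Psi>\<^sub>m_def)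
  qed
  have \<Psi>_mono: "\<Psi> x \<le> \<Psi> y" and \<Psi>\<^sub>m_mono: "\<Psi>\<^sub>m x \<le> \<Psi>\<^sub>m y" and \<Psi>\<^sub>m_le: "\<Psi>\<^sub>m x \<le> \<Psi> y"
    if "0 \<le> x" "x \<le> y" "y \<le> 1" for x y
    unfolding \<Psi>_def \<Psi>\<^sub>m_def
    by (rule threshold_series_mono; use moments w_moments h_pos that in \<open>simp add: w_def\<close>)+
  have \<Psi>_step: "prob (threshold_step h UNIV T) = \<Psi> (prob T)" if "T \<in> sets tree_algebra" for T
    using measure_threshold_step[OF that, of chi h UNIV] by (simp add: \<Psi>_def)
  have \<Psi>\<^sub>m_step: "prob (threshold_step h {l. h l \<le> m} T) = \<Psi>\<^sub>m (prob T)" if "T \<in> sets tree_algebra" for T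
    using measure_threshold_step[OF that, of chi h "{l. h l \<le> m}"] unfolding \<Psi>\<^sub>m_def w_def .
  have x\<^sub>0_fixed: "\<Psi> x\<^sub>0 = x\<^sub>0"
    using assms(7-9) automaton_map_eq_threshold_series[of x\<^sub>0 chi h] by (simp add: \<Psi>_def)

  define q where "q = prob (bounded_event h m)"
  have q_fixed: "\<Psi>\<^sub>m q = q"
    unfolding q_def using \<Psi>\<^sub>m_step[OF bounded_event_measurable[of h m]] by (simp add: bounded_event_fixed)
  \<comment> \<open>Discarding the thresholds above \<open>m\<close> keeps the expansion at \<open>0\<close> up to order \<open>m\<close>, so \<open>\<Psi>\<^sub>m\<close> still
    exceeds the identity near \<open>0\<close>, and its iterates from \<open>1\<close> cannot fall below such a point.\<close>
  have "q > 0"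
  proof -
    obtain \<delta> where \<delta>: "0 < \<delta>" "\<delta> \<le> 1" "\<And>x. 0 < x \<Longrightarrow> x < \<delta> \<Longrightarrow> threshold_series h low_weights 0 x > 0"
      using low_positive_near_0 by blast
    define p where "p = \<delta> / 2"
    have p: "0 < p" "p < \<delta>" "p \<le> 1" using \<delta>(1,2) by (auto simp: p_def)
    have \<Psi>p: "p \<le> \<Psi>\<^sub>m p" using \<delta>(3)[OF p(1,2)] low_eq[of p] p by simp
    have "p \<le> prob (bounded_up_to h m n)" for n
    proof (induction n)
      case 0
      show ?case using prob_space p(3) by simp
    next
      case (Suc n)
      have "\<Psi>\<^sub>m p \<le> \<Psi>\<^sub>m (prob (bounded_up_to h m n))"
        using Suc p by (intro \<Psi>\<^sub>m_mono) auto
      then show ?case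
        using \<Psi>p \<Psi>\<^sub>m_step[OF bounded_up_to_measurable[of h m n]] by (simp add: bounded_up_to_Suc)
    qed
    moreover have "(\<lambda>n. prob (bounded_up_to h m n)) \<longlonglongrightarrow> q"
      unfolding q_def bounded_event_def
      by (rule finite_Lim_measure_decseq) (auto simp: bounded_up_to_measurable decseq_bounded_up_to)
    ultimately have "p \<le> q" by (intro LIMSEQ_le_const) auto
    then show ?thesis using p by simp
  qed
  \<comment> \<open>By single crossing \<open>\<Psi>\<^sub>m\<close>, and with it \<open>\<Psi>\<close>, exceeds the identity on the whole interval from \<open>0\<close>
    to \<open>q\<close>, which leaves no room for a fixed point of \<open>\<Psi>\<close> there.\<close>
  have "q \<le> x\<^sub>0"
  proof (rule ccontr)
    assume "\<not> q \<le> x\<^sub>0"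
    then have "threshold_series h low_weights 0 x\<^sub>0 > 0"
      using assms(7) low_eq[of q] q_fixed by (intro low_positive_before[of q]) (auto simp: q_def)
    then have "x\<^sub>0 < \<Psi>\<^sub>m x\<^sub>0" using low_eq[of x\<^sub>0] assms(7,8) by simp
    also have "\<dots> \<le> \<Psi> x\<^sub>0" using assms(7,8) by (intro \<Psi>\<^sub>m_le) auto
    finally show False using x\<^sub>0_fixed by simp
  qed

  have E_measurable: "?E \<in> sets tree_algebra"
    unfolding eventually_bounded_admissible_event_eq
    by (intro sets.countable_UN image_subsetI bounded_from_measurable)
  have E_step: "threshold_step h UNIV ?E = ?E"
    unfolding eventually_bounded_admissible_event_eq by (rule bounded_from_fixed)
  have E_fixed: "\<Psi> (prob ?E) = prob ?E"
    using \<Psi>_step[OF E_measurable] by (simp add: E_step)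
  have lim: "(\<lambda>n. prob (bounded_from h m n)) \<longlonglongrightarrow> prob ?E"
    unfolding eventually_bounded_admissible_event_eq
    by (rule finite_Lim_measure_incseq) (auto simp: bounded_from_measurable incseq_bounded_from)
  have "prob (bounded_from h m n) \<le> x\<^sub>0" for n
  proof (induction n)
    case 0
    show ?case using \<open>q \<le> x\<^sub>0\<close> by (simp add: q_def)
  next
    case (Suc n)
    have "\<Psi> (prob (bounded_from h m n)) \<le> \<Psi> x\<^sub>0"
      using Suc assms(8) by (intro \<Psi>_mono) auto
    then show ?case
      using x\<^sub>0_fixed \<Psi>_step[OF bounded_from_measurable[of h m n]] by (simp add: bounded_from_Suc)
  qed
  then have "prob ?E \<le> x\<^sub>0" by (intro LIMSEQ_le_const2[OF lim]) auto
  moreover have "x\<^sub>0 \<le> prob ?E"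
  proof (rule assms(10))
    have "bounded_event h m \<subseteq> ?E"
      using UN_upper[of 0 UNIV "bounded_from h m"] by (simp add: eventually_bounded_admissible_event_eq)
    then have "q \<le> prob ?E"
      unfolding q_def using E_measurable by (intro finite_measure_mono) simp_all
    then show "0 < prob ?E" using \<open>q > 0\<close> by simp
    show "automaton_map chi h (prob ?E) = prob ?E"
      using E_fixed automaton_map_eq_threshold_series[of "prob ?E" chi h] by (simp add: \<Psi>_def)
  qed simp
  ultimately have prob_E: "prob ?E = x\<^sub>0" by simp

  have "t \<in> ?E \<longleftrightarrow> h (n_children t []) \<le> root_child_count t ?E" if "t \<in> rooted_trees" for t
    using E_step that unfolding threshold_step_def by blast
  then have AE_E: "AE t in GW chi. t \<in> ?E \<longleftrightarrow> root_child_count t ?E \<ge> h (n_children t [])"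
    by (intro AE_I2) simp
  then have E_event: "interpretation_event chi h ?E"
    using E_measurable by (simp add: interpretation_event_def)
  have E_assoc: "associated_interpretation chi h x\<^sub>0 ?E"
    using AE_E E_measurable prob_E by (simp add: associated_interpretation_def interpretation_of_def)
  moreover have "AE t in GW chi. t \<in> \<T> \<longleftrightarrow> t \<in> ?E" if T: "associated_interpretation chi h x\<^sub>0 \<T>" for \<T>
  proof -
    have "interpretation_of chi h \<T>" "measure (completion (GW chi)) \<T> = x\<^sub>0"
      using T by (simp_all add: associated_interpretation_def)
    then obtain S where S: "interpretation_event chi h S" "AE t in GW chi. t \<in> \<T> \<longleftrightarrow> t \<in> S" "prob S = x\<^sub>0"
      using interpretation_of_imp_event by metis
    have "AE t in GW chi. t \<in> S \<longleftrightarrow> t \<in> ?E"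
      using S(3) prob_E by (intro interpretation_event_unique[OF S(1) E_event]) simp
    with S(2) show ?thesis by eventually_elim simp
  qed
  ultimately show ?thesis
    unfolding interpretable_def by blast
qed

end
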